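(* Let $N$ be an odd positive integer. (Simple version) Suppose that there is a simple holomorphic eta quotient of level $N$. Then there are at least two simple holomorphic eta quotients of level $2N$ and at least three simple holomorphic eta quotients of level $4N$. Moreover, if $3\nmid N$, then there are also at least four simple holomorphic eta quotients of level $6N$ and at least four simple holomorphic eta quotients of level $12N$. (Irreducible version) Suppose that there is an irreducible holomorphic eta quotient of level $N$. Then there are at least two irreducible holomorphic eta quotients of level $2N$ and at least three irreducible holomorphic eta quotients of level $4N$. Moreover, if $3\nmid N$, then there are also at least four irreducible holomorphic eta quotients of level $6N$ and at least four irreducible holomorphic eta quotients of level $12N$.
   Context: Let $\mathfrak{H}=\{\tau\in\mathbb{C}:\operatorname{Im}(\tau)>0\}$. The Dedekind eta function is $\eta(z)=e^{\pi i z/12}\prod_{n=1}^\infty(1-e^{2\pi i n z})$ for $z\in\mathfrak{H}$, and for a positive integer $d$, $\eta_d(z):=\eta(dz)$. An eta quotient is a finite product $f=\prod_d \eta_d^{X_d}$ with $d$ positive integers and $X_d\in\mathbb{Z}$; its level is $N=\operatorname{lcm}\{d: X_d\neq 0\}$. It transforms like a modular form of weight $\frac12\sum_d X_d$ with a multiplier system on $\Gamma_0(N)$. An eta quotient of level $N$ is called holomorphic if it has no pole at any cusp of $\Gamma_0(N)$. Up to a positive factor, the order of $f$ at a cusp $a/t$ of $\Gamma_0(N)$ with $t\mid N$, $\gcd(a,t)=1$, is $\sum_{d\mid N}\frac{\gcd(d,t)^2}{d}X_d$, so holomorphy means that this sum is $\geq 0$ for every $t\mid N$. An eta quotient $f$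 is primitive if there does not exist any other eta quotient $h$ and any positive integer $\nu$ such that $f(z)=h(\nu z)$ for all $z\in\mathfrak{H}$. An eta quotient on $\Gamma_0(M)$ is an eta quotient whose level divides $M$. If $f,g,h$ are nonconstant holomorphic eta quotients on $\Gamma_0(M)$ with $f=g\cdot h$, then $f$ is said to be factorizable on $\Gamma_0(M)$. A holomorphic eta quotient $f$ of level $N$ is quasi-irreducible if it is not factorizable on $\Gamma_0(N)$, and irreducible if it is not factorizable on $\Gamma_0(M)$ for any multiple $M$ of $N$. A holomorphic eta quotient is simple if it is both primitive and quasi-irreducible. *)

theory Defs
  imports "HOL-Analysis.Analysis"
begin

definition upper_half_plane :: "complex set" where
  "upper_half_plane = {z. Im z > 0}"

definition dedekind_eta :: "complex \<Rightarrow> complex" where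
  "dedekind_eta z =
     exp (of_real pi * \<i> * z / 12) *
     (\<Prod>n. 1 - exp (2 * of_real pi * \<i> * of_nat (Suc n) * z))"

text \<open>
  Exponent families (X d), indexed by the positive integers and finitely supported. The index
  type also contains 0, which is therefore excluded from the support.
\<close>

definition eta_exponents :: "(nat \<Rightarrow> int) \<Rightarrow> bool" where
  "eta_exponents X \<longleftrightarrow> finite {d. X d \<noteq> 0} \<and> X 0 = 0"

text \<open>
  Eta quotients are functions on the upper half plane. They are made extensional by
  \<^const>\<open>restrict\<close>, so that HOL equality is equality of functions on the upper half plane;
  this matters when eta quotients are counted.
\<close>

definition eta_quotient :: "(nat \<Rightarrow> int) \<Rightarrow> complex \<Rightarrow> complex" where
  "eta_quotient X =
     (\<lambda>z\<in>upper_half_plane. \<Prod>d | X d \<noteq> 0. dedekind_eta (of_nat d * z) powi X d)"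

definition is_eta_quotient :: "(complex \<Rightarrow> complex) \<Rightarrow> bool" where
  "is_eta_quotient f \<longleftrightarrow> (\<exists>X. eta_exponents X \<and> f = eta_quotient X)"

definition has_level :: "(complex \<Rightarrow> complex) \<Rightarrow> nat \<Rightarrow> bool" where
  "has_level f N \<longleftrightarrow>
     (\<exists>X. eta_exponents X \<and> f = eta_quotient X \<and> N = Lcm {d. X d \<noteq> 0})"

definition has_weight :: "(complex \<Rightarrow> complex) \<Rightarrow> real \<Rightarrow> bool" where
  "has_weight f k \<longleftrightarrow>
     (\<exists>X. eta_exponents X \<and> f = eta_quotient X \<and> k = (\<Sum>d | X d \<noteq> 0. of_int (X d)) / 2)"

text \<open>
  The weight-k slash action of the matrix (a b; c d). The weight may be half-integral; the principal
  branch of the power is used, and other branches change the value only by a factor of modulus 1.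
\<close>

definition slash ::
  "real \<Rightarrow> int \<Rightarrow> int \<Rightarrow> int \<Rightarrow> int \<Rightarrow> (complex \<Rightarrow> complex) \<Rightarrow> complex \<Rightarrow> complex" where
  "slash k a b c d f z =
     (of_int c * z + of_int d) powr (- of_real k) *
     f ((of_int a * z + of_int b) / (of_int c * z + of_int d))"

text \<open>
  A matrix (a b; c d) of determinant 1 moves the cusp at infinity to a/c. Absence of a pole at
  a/c means that the slashed function stays bounded as Im z tends to infinity. All of
  SL(2,Z) is considered, so every cusp of every congruence subgroup is covered, each
  through all of its representatives.
\<close>

definition no_pole_at_cusps :: "real \<Rightarrow> (complex \<Rightarrow> complex) \<Rightarrow> bool" where
  "no_pole_at_cusps k f \<longleftrightarrow>
     (\<forall>a b c d. a * d - b * c = 1 \<longrightarrow> Bfun (slash k a b c d f) (filtercomap Im at_top))"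

definition holomorphic_eta_quotient :: "(complex \<Rightarrow> complex) \<Rightarrow> bool" where
  "holomorphic_eta_quotient f \<longleftrightarrow> (\<exists>k. has_weight f k \<and> no_pole_at_cusps k f)"

definition on_Gamma0 :: "nat \<Rightarrow> (complex \<Rightarrow> complex) \<Rightarrow> bool" where
  "on_Gamma0 M f \<longleftrightarrow> (\<exists>N. has_level f N \<and> N dvd M)"

definition nonconstant_holomorphic_on_Gamma0 :: "nat \<Rightarrow> (complex \<Rightarrow> complex) \<Rightarrow> bool" where
  "nonconstant_holomorphic_on_Gamma0 M f \<longleftrightarrow>
     holomorphic_eta_quotient f \<and> on_Gamma0 M f \<and> \<not> f constant_on upper_half_plane"

definition factorizable_on_Gamma0 :: "nat \<Rightarrow> (complex \<Rightarrow> complex) \<Rightarrow> bool" where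
  "factorizable_on_Gamma0 M f \<longleftrightarrow>
     nonconstant_holomorphic_on_Gamma0 M f \<and>
     (\<exists>g h. nonconstant_holomorphic_on_Gamma0 M g \<and>
            nonconstant_holomorphic_on_Gamma0 M h \<and>
            (\<forall>z\<in>upper_half_plane. f z = g z * h z))"

definition primitive_eta_quotient :: "(complex \<Rightarrow> complex) \<Rightarrow> bool" where
  "primitive_eta_quotient f \<longleftrightarrow>
     is_eta_quotient f \<and>
     \<not> (\<exists>h \<nu>::nat. is_eta_quotient h \<and> h \<noteq> f \<and> \<nu> > 0 \<and>
            (\<forall>z\<in>upper_half_plane. f z = h (of_nat \<nu> * z)))"

definition quasi_irreducible :: "nat \<Rightarrow> (complex \<Rightarrow> complex) \<Rightarrow> bool" where
  "quasi_irreducible N f \<longleftrightarrow>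
     holomorphic_eta_quotient f \<and> has_level f N \<and> \<not> factorizable_on_Gamma0 N f"

text \<open>
  The multiples M are positive: every number divides 0, so M = 0 would impose no bound on
  the levels of the factors.
\<close>

definition irreducible_eta_quotient :: "nat \<Rightarrow> (complex \<Rightarrow> complex) \<Rightarrow> bool" where
  "irreducible_eta_quotient N f \<longleftrightarrow>
     holomorphic_eta_quotient f \<and> has_level f N \<and>
     (\<forall>M>0. N dvd M \<longrightarrow> \<not> factorizable_on_Gamma0 M f)"

definition simple_eta_quotient :: "nat \<Rightarrow> (complex \<Rightarrow> complex) \<Rightarrow> bool" where
  "simple_eta_quotient N f \<longleftrightarrow> primitive_eta_quotient f \<and> quasi_irreducible N f"

definition at_least :: "nat \<Rightarrow> ('a \<Rightarrow> bool) \<Rightarrow> bool" where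
  "at_least m P \<longleftrightarrow> (\<exists>S. finite S \<and> card S = m \<and> (\<forall>x\<in>S. P x))"

end

theory Submission
  imports Defs "HOL-Complex_Analysis.Complex_Analysis" "HOL-Number_Theory.Totient"
    "HOL-Real_Asymp.Real_Asymp"
begin

text \<open>
  Given a suitable nonconstant eta quotient \<open>f = \<Prod>\<eta>\<^sub>d\<^bsup>X d\<^esup>\<close> of level \<open>N\<close>, further ones are obtained as products
  \<open>f \<otimes> g = \<Prod>\<eta>\<^bsub>de\<^esub>\<^bsup>X d Y e\<^esup>\<close>, where \<open>g = \<Prod>\<eta>\<^sub>e\<^bsup>Y e\<^esup>\<close> runs through the known primitive holomorphic eta quotients
  of weight \<open>1/2\<close> whose level \<open>M\<close> is 2, 4, 6 or 12 and prime to \<open>N\<close>. There are 2, 3, 4 and 4 of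
  them. Different \<open>g\<close> give different products, the level of \<open>f \<otimes> g\<close> is \<open>M N\<close>, and \<open>f \<otimes> g\<close> is primitive if
  \<open>f\<close> is.

  It remains to see that \<open>f \<otimes> g\<close> does not factor if \<open>f\<close> does not. A holomorphic factor of \<open>f \<otimes> g\<close> is a
  family of exponents \<open>Z\<close> on the divisors \<open>de\<close> of \<open>N M\<close>. Sum it over \<open>e\<close>. The result is integral, and it
  is again holomorphic on the divisors of \<open>N\<close>, because by the valence formula the functional
  \<open>Y \<mapsto> \<Sum>Y\<^sub>e\<close>, twice the weight, is a combination of the orders at the cusps with positive coefficients
  (\<open>strictly_positive_weight_exists\<close>, \<open>cusp_order_partial_weight\<close>). For \<open>f \<otimes> g\<close> itself the sum is \<open>X\<close>, as
  \<open>g\<close> has weight \<open>1/2\<close>. So a factorization of \<open>f \<otimes> g\<close> gives one of \<open>f\<close>, and it is nontrivial since all the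
  coefficients are strictly positive (\<open>irreducible_exponents_product\<close>). The argument works for all
  pairs of coprime multiples of \<open>N\<close> and \<open>M\<close>, and every multiple of \<open>N M\<close> is a product of such a pair; this
  gives the irreducible version as well as the simple one.

  This reasoning takes place on exponents. Its link with functions is that absence of poles at the
  cusps means \<open>\<Sum>gcd(c, d)\<^sup>2 / d X\<^sub>d \<ge> 0\<close> for all \<open>c\<close> (\<open>holomorphic_eta_quotient_iff\<close>) and that an eta
  quotient determines its exponents (\<open>eta_quotient_inject\<close>). Both follow from the growth of eta at
  the cusps, hence from the inversion formula \<open>\<bar>\<eta>(-1/z)\<bar>\<^sup>2 = \<bar>z\<bar> \<bar>\<eta>(z)\<bar>\<^sup>2\<close> (\<open>dedekind_eta_S_norm\<close>).
  The formula is derived from Liouville's theorem: two theta functions, given as infinite products,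
  have a constant quotient, and the constant is determined twice, by the derivatives at 0 and by
  Euler's product identity at the half periods.
\<close>

section \<open>The infinite product\<close>

text \<open>
  The q-Pochhammer symbol \<open>(a; q)\<^sub>\<infinity>\<close>. Keeping \<open>a\<close> apart from \<open>q\<close> makes one function serve for the
  eta product, for the theta function below and for the products over half-integral exponents that
  appear at its half periods.
\<close>

definition qprod :: "complex \<Rightarrow> complex \<Rightarrow> complex" where
  "qprod a q = (\<Prod>n. 1 - a * q ^ n)"

lemma qprod_convergent:
  fixes a q :: complex
  assumes "norm q < 1"
  shows "convergent_prod (\<lambda>n. 1 - a * q ^ n)"
proof -
  have "summable (\<lambda>n. norm a * norm q ^ n)"
    using assms by (intro summable_mult summable_geometric) simp
  moreover have "(\<lambda>n. norm a * norm q ^ n) = (\<lambda>n. norm (- a * q ^ n))"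
    by (simp add: norm_mult norm_power)
  ultimately have "summable (\<lambda>n. norm (- a * q ^ n))"
    by (simp only:)
  hence "abs_convergent_prod (\<lambda>n. 1 + (- a * q ^ n))"
    by (subst abs_convergent_prod_conv_summable) simp
  thus ?thesis
    using abs_convergent_prod_imp_convergent_prod by fastforce
qed

lemma qprod_LIMSEQ:
  assumes "norm q < 1"
  shows "(\<lambda>N. \<Prod>n<N. 1 - a * q ^ n) \<longlonglongrightarrow> qprod a q"
proof -
  have "(\<lambda>N. \<Prod>n\<le>N. 1 - a * q ^ n) \<longlonglongrightarrow> qprod a q"
    unfolding qprod_def by (rule convergent_prod_LIMSEQ[OF qprod_convergent[OF assms]])
  thus ?thesis
    using LIMSEQ_lessThan_iff_atMost by blast
qed

lemma qprod_eq_0_iff: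
  assumes "norm q < 1"
  shows "qprod a q = 0 \<longleftrightarrow> (\<exists>n. a * q ^ n = 1)"
proof -
  have "(\<lambda>n. 1 - a * q ^ n) has_prod qprod a q"
    unfolding qprod_def using qprod_convergent[OF assms] by (simp add: convergent_prod_has_prod_iff)
  from has_prod_eq_0_iff[OF this] show ?thesis
    by (auto simp: image_iff)
qed

lemma qprod_rec:
  assumes "norm q < 1"
  shows "qprod a q = (1 - a) * qprod (a * q) q"
proof -
  have "(\<lambda>N. \<Prod>n<Suc N. 1 - a * q ^ n) \<longlonglongrightarrow> qprod a q"
    by (rule LIMSEQ_Suc[OF qprod_LIMSEQ[OF assms]])
  moreover have "(\<Prod>n<Suc N. 1 - a * q ^ n) = (1 - a) * (\<Prod>n<N. 1 - a * q * q ^ n)" for N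
    by (subst prod.lessThan_Suc_shift) (simp add: mult.assoc)
  ultimately have "(\<lambda>N. (1 - a) * (\<Prod>n<N. 1 - a * q * q ^ n)) \<longlonglongrightarrow> qprod a q"
    by (simp only:)
  moreover have "(\<lambda>N. (1 - a) * (\<Prod>n<N. 1 - a * q * q ^ n)) \<longlonglongrightarrow> (1 - a) * qprod (a * q) q"
    by (intro tendsto_mult tendsto_const qprod_LIMSEQ assms)
  ultimately show ?thesis
    by (rule LIMSEQ_unique)
qed

lemma qprod_mult_minus:
  assumes "norm q < 1"
  shows "qprod a q * qprod (- a) q = qprod (a\<^sup>2) (q\<^sup>2)"
proof -
  have q2: "norm (q\<^sup>2) < 1"
    using assms by (simp add: norm_power power_less_one_iff)
  have "(\<lambda>N. (\<Prod>n<N. 1 - a * q ^ n) * (\<Prod>n<N. 1 - (- a) * q ^ n)) \<longlonglongrightarrow> qprod a q * qprod (- a) q"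
    by (intro tendsto_intros qprod_LIMSEQ assms)
  moreover have "(\<Prod>n<N. 1 - a * q ^ n) * (\<Prod>n<N. 1 - (- a) * q ^ n) = (\<Prod>n<N. 1 - a\<^sup>2 * (q\<^sup>2) ^ n)" for N
  proof -
    have "(1 - a * q ^ n) * (1 - (- a) * q ^ n) = 1 - a\<^sup>2 * (q\<^sup>2) ^ n" for n
    proof -
      have "(q\<^sup>2) ^ n = (q ^ n)\<^sup>2"
        by (simp only: power_mult [symmetric] mult.commute)
      thus ?thesis
        by (simp only: power2_eq_square) (simp add: algebra_simps)
    qed
    thus ?thesis
      by (simp only: prod.distrib [symmetric])
  qed
  ultimately show ?thesis
    using qprod_LIMSEQ[OF q2, of "a\<^sup>2"] LIMSEQ_unique by fastforce
qed

lemma qprod_split_parity: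
  assumes "norm q < 1"
  shows "qprod a q = qprod a (q\<^sup>2) * qprod (a * q) (q\<^sup>2)"
proof -
  have q2: "norm (q\<^sup>2) < 1"
    using assms by (simp add: norm_power power_less_one_iff)
  have "(\<lambda>N. (\<Prod>n<N. 1 - a * (q\<^sup>2) ^ n) * (\<Prod>n<N. 1 - a * q * (q\<^sup>2) ^ n)) \<longlonglongrightarrow>
          qprod a (q\<^sup>2) * qprod (a * q) (q\<^sup>2)"
    by (intro tendsto_intros qprod_LIMSEQ q2)
  moreover have "(\<Prod>n<N. 1 - a * (q\<^sup>2) ^ n) * (\<Prod>n<N. 1 - a * q * (q\<^sup>2) ^ n) =
                   (\<Prod>n<2*N. 1 - a * q ^ n)" for N
    by (induction N) (simp_all add: power_mult [symmetric] mult_ac)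
  moreover have "(\<lambda>N. \<Prod>n<2*N. 1 - a * q ^ n) \<longlonglongrightarrow> qprod a q"
    using LIMSEQ_subseq_LIMSEQ[OF qprod_LIMSEQ[OF assms, of a], of "\<lambda>N. 2 * N"]
    by (simp add: o_def strict_mono_def)
  ultimately show ?thesis
    using LIMSEQ_unique by fastforce
qed

text \<open>
  Euler's identity between partitions into distinct and into odd parts. Both sides of
  \<open>(q; q)\<^sub>\<infinity> (-q; q)\<^sub>\<infinity> = (q\<^sup>2; q\<^sup>2)\<^sub>\<infinity>\<close> contain the nonzero factor \<open>(q\<^sup>2; q\<^sup>2)\<^sub>\<infinity>\<close>, because the
  terms of \<open>(q; q)\<^sub>\<infinity>\<close> can be sorted by the parity of the exponent.
\<close>

lemma qprod_euler:
  assumes "norm q < 1"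
  shows "qprod (- q) q * qprod q (q\<^sup>2) = 1"
proof -
  have q2: "norm (q\<^sup>2) < 1"
    using assms by (simp add: norm_power power_less_one_iff)
  have "qprod (q\<^sup>2) (q\<^sup>2) \<noteq> 0"
  proof
    assume "qprod (q\<^sup>2) (q\<^sup>2) = 0"
    then obtain n where "q\<^sup>2 * (q\<^sup>2) ^ n = 1"
      using qprod_eq_0_iff[OF q2] by blast
    hence "norm ((q\<^sup>2) ^ Suc n) = 1"
      by simp
    hence "norm (q\<^sup>2) ^ Suc n = 1"
      by (simp only: norm_power)
    moreover have "norm (q\<^sup>2) ^ Suc n < 1"
      using q2 power_less_one_iff[of "norm (q\<^sup>2)" "Suc n"] by simp
    ultimately show False
      by simp
  qed
  moreover have "qprod q q * qprod (- q) q = qprod (q\<^sup>2) (q\<^sup>2)"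
    by (rule qprod_mult_minus[OF assms])
  moreover have "qprod q q = qprod q (q\<^sup>2) * qprod (q\<^sup>2) (q\<^sup>2)"
    using qprod_split_parity[OF assms, of q] by (simp add: power2_eq_square)
  ultimately show ?thesis
    by (simp add: field_simps)
qed

lemma qprod_holomorphic:
  assumes "norm q < 1"
  shows "(\<lambda>a. qprod a q) holomorphic_on A"
proof (rule holomorphic_on_subset)
  show "(\<lambda>a. qprod a q) holomorphic_on UNIV"
  proof (rule holomorphic_uniform_sequence)
    fix z :: complex
    define R where "R = norm z + 1"
    have "uniformly_convergent_on (cball 0 R) (\<lambda>N a. \<Prod>n<N. 1 - a * q ^ n)"
    proof (rule uniformly_convergent_on_prod')
      show "uniformly_convergent_on (cball 0 R) (\<lambda>N a. \<Sum>n<N. norm ((1 - a * q ^ n) - 1))"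
      proof (rule Weierstrass_m_test')
        show "summable (\<lambda>n. R * norm q ^ n)"
          using assms by (intro summable_mult) simp
        show "norm (norm ((1 - a * q ^ n) - 1)) \<le> R * norm q ^ n" if "a \<in> cball 0 R" for n a
          using that by (auto simp: norm_mult norm_power intro!: mult_right_mono)
      qed
    qed (auto intro!: continuous_intros)
    then obtain g where g: "uniform_limit (cball 0 R) (\<lambda>N a. \<Prod>n<N. 1 - a * q ^ n) g sequentially"
      unfolding uniformly_convergent_on_def by blast
    have "g a = qprod a q" if "a \<in> cball 0 R" for a
      using tendsto_uniform_limitI[OF g that] qprod_LIMSEQ[OF assms] LIMSEQ_unique by blast
    hence "uniform_limit (cball 0 R) (\<lambda>N a. \<Prod>n<N. 1 - a * q ^ n) (\<lambda>a. qprod a q) sequentially"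
      using g by (subst uniform_limit_cong'[where g = "\<lambda>N a. \<Prod>n<N. 1 - a * q ^ n" and i = g]) auto
    hence "uniform_limit (cball z 1) (\<lambda>N a. \<Prod>n<N. 1 - a * q ^ n) (\<lambda>a. qprod a q) sequentially"
      by (rule uniform_limit_on_subset) (simp add: cball_subset_cball_iff R_def)
    thus "\<exists>d>0. cball z d \<subseteq> UNIV \<and>
            uniform_limit (cball z d) (\<lambda>N a. \<Prod>n<N. 1 - a * q ^ n) (\<lambda>a. qprod a q) sequentially"
      by (intro exI[of _ 1]) auto
  qed (auto intro!: holomorphic_intros)
qed auto

text \<open>
  Explicit constants are chosen so that the logarithm of the product stays in \<open>[-1, 1]\<close>; this is
  all that the growth of eta at a cusp requires of the product.
\<close>

lemma qprod_norm_bounds: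
  assumes "norm q \<le> 1 / 4"
  shows "2 / 3 \<le> norm (qprod q q)" "norm (qprod q q) \<le> 2"
proof -
  have q1: "norm q < 1" using assms by simp
  define r where "r = norm q"
  have r: "0 \<le> r" "r \<le> 1/4" using assms by (auto simp: r_def)
  have lim: "(\<lambda>N. norm (\<Prod>n<N. 1 - q * q ^ n)) \<longlonglongrightarrow> norm (qprod q q)"
    by (intro tendsto_norm qprod_LIMSEQ q1)
  have geo: "(\<Sum>n<N. r ^ Suc n) \<le> 1 / 3" for N
  proof -
    have s: "(\<lambda>n. r * r ^ n) sums (r * (1 / (1 - r)))"
      using r by (intro sums_mult geometric_sums) auto
    have "(\<Sum>n<N. r ^ Suc n) \<le> r * (1 / (1 - r))"
      using sum_le_suminf[OF sums_summable[OF s], of "{..<N}"] sums_unique[OF s] r by simp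
    also have "\<dots> \<le> 1 / 3" using r by (simp add: field_simps)
    finally show ?thesis .
  qed
  have fac: "1 - r ^ Suc n \<le> norm (1 - q * q ^ n)" "norm (1 - q * q ^ n) \<le> 1 + r ^ Suc n" for n
    using norm_triangle_ineq2[of 1 "q * q ^ n"] norm_triangle_ineq4[of 1 "q * q ^ n"]
    by (simp_all add: norm_mult norm_power r_def)
  have pw: "r ^ Suc n \<in> {0..1}" for n
    using r by (auto intro!: power_le_one simp del: power_Suc)
  have "2 / 3 \<le> norm (\<Prod>n<N. 1 - q * q ^ n)" for N
  proof -
    have "2 / 3 \<le> 1 - (\<Sum>n<N. r ^ Suc n)" using geo[of N] by simp
    also have "\<dots> \<le> (\<Prod>n<N. 1 - r ^ Suc n)"
      by (rule Weierstrass_prod_ineq) (use pw in blast)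
    also have "\<dots> \<le> (\<Prod>n<N. norm (1 - q * q ^ n))"
      using pw fac(1) by (intro prod_mono) (auto simp del: power_Suc)
    finally show ?thesis by (simp add: prod_norm)
  qed
  thus "2 / 3 \<le> norm (qprod q q)"
    by (intro LIMSEQ_le_const[OF lim] exI[of _ 0] allI impI)
  have "norm (\<Prod>n<N. 1 - q * q ^ n) \<le> 2" for N
  proof -
    have "(\<Prod>n<N. norm (1 - q * q ^ n)) \<le> (\<Prod>n<N. exp (r ^ Suc n))"
    proof (intro prod_mono conjI)
      show "norm (1 - q * q ^ n) \<le> exp (r ^ Suc n)" for n
        using fac(2)[of n] exp_ge_add_one_self[of "r ^ Suc n"] by linarith
    qed auto
    also have "\<dots> = exp (\<Sum>n<N. r ^ Suc n)" by (simp add: exp_sum)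
    also have "\<dots> \<le> exp (1 / 3)" using geo[of N] by simp
    also have "\<dots> \<le> 2" using exp_bound[of "1/3"] by (simp add: power2_eq_square)
    finally show ?thesis by (simp add: prod_norm)
  qed
  thus "norm (qprod q q) \<le> 2"
    by (intro LIMSEQ_le_const2[OF lim] exI[of _ 0] allI impI)
qed

section \<open>A theta function\<close>

text \<open>
  The usual \<open>e(w)\<close>, which turns the variables \<open>w\<close>, \<open>z\<close> into the nome variables of the products.
\<close>

definition ee :: "complex \<Rightarrow> complex" where
  "ee w = exp (2 * of_real pi * \<i> * w)"

lemma ee_add: "ee (v + w) = ee v * ee w"
  by (simp add: ee_def distrib_left exp_add)

lemma ee_diff: "ee (v - w) = ee v / ee w"
  by (simp add: ee_def right_diff_distrib exp_diff)

lemma ee_minus: "ee (- w) = inverse (ee w)"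
  by (simp add: ee_def exp_minus)

lemma ee_nonzero [simp]: "ee w \<noteq> 0"
  by (simp add: ee_def)

lemma ee_0 [simp]: "ee 0 = 1"
  by (simp add: ee_def)

lemma ee_of_int [simp]: "ee (of_int n) = 1"
  using exp_integer_2pi[of "of_int n"] by (simp add: ee_def mult_ac)

lemma ee_1 [simp]: "ee 1 = 1"
  using ee_of_int[of 1] by simp

lemma ee_half [simp]: "ee (1 / 2) = -1"
  using exp_pi_i by (simp add: ee_def)

lemma ee_power: "ee w ^ n = ee (of_nat n * w)"
  by (simp add: ee_def exp_of_nat_mult [symmetric] mult_ac)

lemma ee_eq_1_iff: "ee w = 1 \<longleftrightarrow> (\<exists>m::int. w = of_int m)"
proof
  assume "ee w = 1"
  then obtain n :: int where "Im w = 0" "2 * pi * Re w = of_int (2 * n) * pi"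
    unfolding ee_def exp_eq_1 by auto
  hence "w = of_int n"
    by (intro complex_eqI) auto
  thus "\<exists>m::int. w = of_int m" ..
qed auto

lemma norm_ee: "norm (ee w) = exp (- 2 * pi * Im w)"
  by (simp add: ee_def)

lemma norm_ee_less_1: "Im z > 0 \<Longrightarrow> norm (ee z) < 1"
  by (simp add: norm_ee)

lemma ee_holomorphic [holomorphic_intros]:
  "f holomorphic_on A \<Longrightarrow> (\<lambda>w. ee (f w)) holomorphic_on A"
  unfolding ee_def by (intro holomorphic_intros)

lemma qprod_ee_holomorphic:
  assumes "Im z > 0" "f holomorphic_on A"
  shows "(\<lambda>w. qprod (ee (f w)) (ee z)) holomorphic_on A"
  using holomorphic_on_compose[OF ee_holomorphic[OF assms(2)] qprod_holomorphic[OF norm_ee_less_1[OF assms(1)]]]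
  by (simp add: o_def)

text \<open>
  Up to a factor without zeros this is the Jacobi theta function \<open>\<theta>\<^sub>1\<close>, defined by its product so that
  the zeros can be read off.
\<close>

definition theta :: "complex \<Rightarrow> complex \<Rightarrow> complex" where
  "theta w z = qprod (ee w) (ee z) * qprod (ee (z - w)) (ee z)"

lemma theta_plus_1: "theta (w + 1) z = theta w z"
  by (simp add: theta_def ee_add ee_diff)

text \<open>
  Shifting \<open>w\<close> by \<open>z\<close> moves one linear factor from the first product to the second:
  \<open>1 - e(w)\<close> is lost and \<open>1 - e(-w)\<close> is gained.
\<close>

lemma theta_plus_period:
  assumes "Im z > 0"
  shows "theta (w + z) z = - ee (- w) * theta w z"
proof -
  note q = norm_ee_less_1[OF assms]
  have "theta (w + z) z = qprod (ee w * ee z) (ee z) * qprod (ee (- w)) (ee z)"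
    by (simp add: theta_def ee_add)
  also have "qprod (ee (- w)) (ee z) = (1 - ee (- w)) * qprod (ee (z - w)) (ee z)"
    by (subst qprod_rec[OF q]) (simp add: ee_add [symmetric])
  also have "1 - ee (- w) = - ee (- w) * (1 - ee w)"
    by (simp add: ee_minus field_simps)
  also have "qprod (ee w * ee z) (ee z) * (- ee (- w) * (1 - ee w) * qprod (ee (z - w)) (ee z)) =
               - ee (- w) * (((1 - ee w) * qprod (ee w * ee z) (ee z)) * qprod (ee (z - w)) (ee z))"
    by (simp only: mult_ac)
  also have "(1 - ee w) * qprod (ee w * ee z) (ee z) = qprod (ee w) (ee z)"
    by (rule qprod_rec[OF q, symmetric])
  finally show ?thesis
    by (simp only: theta_def)
qed

lemma theta_holomorphic:
  assumes "Im z > 0"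
  shows "(\<lambda>w. theta w z) holomorphic_on A"
  unfolding theta_def by (intro holomorphic_intros qprod_ee_holomorphic assms)

lemma theta_eq_0_iff:
  assumes "Im z > 0"
  shows "theta w z = 0 \<longleftrightarrow> (\<exists>m n::int. w = of_int m + of_int n * z)"
proof -
  note q = norm_ee_less_1[OF assms]
  have "theta w z = 0 \<longleftrightarrow> (\<exists>n. ee (w + of_nat n * z) = 1) \<or> (\<exists>n. ee (z - w + of_nat n * z) = 1)"
    by (simp add: theta_def qprod_eq_0_iff[OF q] ee_power ee_add)
  also have "\<dots> \<longleftrightarrow> (\<exists>m n::int. w = of_int m + of_int n * z)"
  proof safe
    fix n assume "ee (w + of_nat n * z) = 1"
    then obtain m :: int where "w + of_nat n * z = of_int m" by (auto simp: ee_eq_1_iff)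
    hence "w = of_int m + of_int (- int n) * z" by (simp add: algebra_simps)
    thus "\<exists>m n::int. w = of_int m + of_int n * z" by blast
  next
    fix n assume "ee (z - w + of_nat n * z) = 1"
    then obtain m :: int where "z - w + of_nat n * z = of_int m" by (auto simp: ee_eq_1_iff)
    hence "w = of_int (- m) + of_int (1 + int n) * z" by (simp add: algebra_simps)
    thus "\<exists>m n::int. w = of_int m + of_int n * z" by blast
  next
    fix m n :: int
    assume *: "\<nexists>k. ee (z - (of_int m + of_int n * z) + of_nat k * z) = 1"
    have "n \<le> 0"
    proof (rule ccontr)
      assume "\<not> n \<le> 0"
      hence "z - (of_int m + of_int n * z) + of_nat (nat (n - 1)) * z = of_int (- m)"
        by (simp add: of_nat_nat algebra_simps)
      with * ee_of_int[of "- m"] show False by metis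
    qed
    hence "of_int m + of_int n * z + of_nat (nat (- n)) * z = of_int m"
      by (simp add: of_nat_nat)
    thus "\<exists>k. ee (of_int m + of_int n * z + of_nat k * z) = 1"
      by (metis ee_of_int)
  qed
  finally show ?thesis .
qed

lemma theta_deriv_0:
  assumes "Im z > 0"
  shows "((\<lambda>w. theta w z) has_field_derivative (-2 * of_real pi * \<i> * (qprod (ee z) (ee z))\<^sup>2)) (at 0)"
proof -
  note q = norm_ee_less_1[OF assms]
  define A where "A = (\<lambda>w. qprod (ee (w + z)) (ee z) * qprod (ee (z - w)) (ee z))"
  have "A holomorphic_on UNIV"
    unfolding A_def by (intro holomorphic_intros qprod_ee_holomorphic assms)
  then obtain D where D: "(A has_field_derivative D) (at 0)"
    using holomorphic_on_imp_differentiable_at[of A UNIV 0] by (auto simp: field_differentiable_def)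
  have eq: "(\<lambda>w. theta w z) = (\<lambda>w. (1 - ee w) * A w)"
    unfolding theta_def A_def ee_add by (subst qprod_rec[OF q]) (simp only: mult.assoc)
  have "((\<lambda>w. 1 - ee w) has_field_derivative (- (2 * of_real pi * \<i>))) (at 0)"
    unfolding ee_def by (auto intro!: derivative_eq_intros)
  from DERIV_mult[OF this D] show ?thesis
    unfolding eq by (simp add: A_def power2_eq_square)
qed

lemma qprod_self_nonzero:
  assumes "Im z > 0"
  shows "qprod (ee z) (ee z) \<noteq> 0"
proof
  assume "qprod (ee z) (ee z) = 0"
  then obtain n where "ee z * ee z ^ n = 1"
    using qprod_eq_0_iff[OF norm_ee_less_1[OF assms]] by blast
  hence "ee (of_nat (Suc n) * z) = 1"
    by (subst ee_power[symmetric]) simp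
  then obtain m :: int where "of_nat (Suc n) * z = of_int m"
    by (auto simp: ee_eq_1_iff)
  hence "Im (of_nat (Suc n) * z) = 0" by simp
  thus False using assms by (simp add: Im_divide_of_nat)
qed

text \<open>
  At a half period the two products in theta are equal or nearly equal, so the three values are,
  up to a factor 2 at \<open>w = 1 / 2\<close>, squares of the products that occur in Euler's identity. The point is that the result does not
  depend on \<open>z\<close>: this fixes the constant in the inversion formula without computing any integral.
\<close>

lemma theta_half_periods:
  assumes "Im z > 0"
  shows "theta (1 / 2) z * theta (z / 2) z * theta ((z + 1) / 2) z = 2"
proof -
  note q = norm_ee_less_1[OF assms]
  define x where "x = ee (z / 2)"
  have xx: "x * x = ee z"
    unfolding x_def by (simp add: ee_add [symmetric])
  hence x2: "x\<^sup>2 = ee z" by (simp add: power2_eq_square)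
  have half: "ee (z - z / 2) = x" "ee ((z + 1) / 2) = - x" "ee (z - (z + 1) / 2) = - x"
    "ee (z - 1 / 2) = - ee z"
  proof -
    have "z - z / 2 = z / 2" by simp
    thus "ee (z - z / 2) = x" by (simp only: x_def)
    have "(z + 1) / 2 = z / 2 + 1 / 2" by (simp add: field_simps)
    thus 1: "ee ((z + 1) / 2) = - x" by (simp only: x_def ee_add ee_half) simp
    show "ee (z - (z + 1) / 2) = - x"
      by (simp only: ee_diff 1 xx [symmetric]) (simp add: x_def)
    show "ee (z - 1 / 2) = - ee z"
      by (simp only: ee_diff ee_half) simp
  qed
  have "theta (1 / 2) z = qprod (-1) (ee z) * qprod (- ee z) (ee z)"
    by (simp add: theta_def half)
  also have "qprod (-1) (ee z) = 2 * qprod (- ee z) (ee z)"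
    by (subst qprod_rec[OF q]) simp
  finally have 1: "theta (1 / 2) z = 2 * (qprod (- ee z) (ee z))\<^sup>2"
    by (simp add: power2_eq_square)
  have 2: "theta (z / 2) z = (qprod x (ee z))\<^sup>2"
    by (simp add: theta_def half power2_eq_square x_def [symmetric])
  have 3: "theta ((z + 1) / 2) z = (qprod (- x) (ee z))\<^sup>2"
    by (simp only: theta_def half power2_eq_square)
  have "qprod x (ee z) * qprod (- x) (ee z) = qprod (ee z) ((ee z)\<^sup>2)"
    using qprod_mult_minus[OF q, of x] by (simp add: x2)
  hence "qprod (- ee z) (ee z) * (qprod x (ee z) * qprod (- x) (ee z)) = 1"
    using qprod_euler[OF q] by simp
  moreover have "theta (1 / 2) z * theta (z / 2) z * theta ((z + 1) / 2) z =
      2 * (qprod (- ee z) (ee z) * (qprod x (ee z) * qprod (- x) (ee z)))\<^sup>2"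
    unfolding 1 2 3 by (simp only: power_mult_distrib mult_ac)
  ultimately show ?thesis by simp
qed

text \<open>
  The space of entire functions with these two quasiperiods is one-dimensional. Since \<open>h\<close> vanishes
  wherever theta has its simple zeros, \<open>h / theta\<close> extends to an elliptic function without poles,
  which is constant by Liouville's theorem. The constant is the value at 0, that is, the quotient
  of the derivatives.
\<close>

lemma theta_quasiperiodic_unique:
  fixes h :: "complex \<Rightarrow> complex"
  assumes z: "Im z > 0"
  assumes hol: "h holomorphic_on UNIV"
  assumes per1: "\<And>w. h (w + 1) = h w"
  assumes perz: "\<And>w. h (w + z) = - ee (- w) * h w"
  assumes h0: "h 0 = 0"
  assumes deriv: "(h has_field_derivative D) (at 0)"
  assumes w: "theta w z \<noteq> 0"
  shows "h w = D / (-2 * of_real pi * \<i> * (qprod (ee z) (ee z))\<^sup>2) * theta w z"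
proof -
  define T where "T = -2 * of_real pi * \<i> * (qprod (ee z) (ee z))\<^sup>2"
  have T: "T \<noteq> 0" using qprod_self_nonzero[OF z] by (simp add: T_def)
  have thT: "((\<lambda>w. theta w z) has_field_derivative T) (at 0)"
    unfolding T_def by (rule theta_deriv_0[OF z])
  define R where "R = (\<lambda>w. if theta w z = 0 then D / T else h w / theta w z)"
  have R1: "R (w + 1) = R w" for w
    by (simp add: R_def theta_plus_1 per1)
  have Rz: "R (w + z) = R w" for w
    by (simp add: R_def theta_plus_period[OF z] perz)
  have Rn: "R (w + of_nat m + of_nat n * z) = R w" for w m n
  proof -
    have "R (w + of_nat m) = R w"
    proof (induction m)
      case (Suc m)
      have "R (w + of_nat (Suc m)) = R ((w + of_nat m) + 1)"
        by (simp add: algebra_simps)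
      thus ?case using R1 Suc by simp
    qed simp
    moreover have "R (w + of_nat m + of_nat n * z) = R (w + of_nat m)"
    proof (induction n)
      case (Suc n)
      have "R (w + of_nat m + of_nat (Suc n) * z) = R ((w + of_nat m + of_nat n * z) + z)"
        by (simp add: algebra_simps)
      thus ?case using Rz Suc by simp
    qed simp
    ultimately show ?thesis by simp
  qed
  have Ri: "R (w + of_int m + of_int n * z) = R w" for w m n
  proof -
    define a b where "a = nat (max 0 (-m))" and "b = nat (max 0 (-n))"
    have "R (w + of_int m + of_int n * z) = R (w + of_int m + of_int n * z + of_nat a + of_nat b * z)"
      by (rule Rn[symmetric])
    also have "w + of_int m + of_int n * z + of_nat a + of_nat b * z =
                 w + of_nat (nat (m + int a)) + of_nat (nat (n + int b)) * z"
      by (simp add: a_def b_def max_def of_nat_nat algebra_simps)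
    also have "R \<dots> = R w" by (rule Rn)
    finally show ?thesis .
  qed
  have diff_off: "R field_differentiable at w" if "theta w z \<noteq> 0" for w
  proof -
    have op: "open {w. theta w z \<noteq> 0}"
      by (intro open_Collect_neq continuous_on_const holomorphic_on_imp_continuous_on theta_holomorphic z)
    have "(\<lambda>w. h w / theta w z) holomorphic_on {w. theta w z \<noteq> 0}"
      by (intro holomorphic_on_divide holomorphic_on_subset[OF hol] theta_holomorphic z) auto
    hence "R holomorphic_on {w. theta w z \<noteq> 0}"
      by (subst holomorphic_cong[OF refl, of _ _ "\<lambda>w. h w / theta w z"]) (auto simp: R_def)
    thus ?thesis
      using op that holomorphic_on_imp_differentiable_at by blast
  qed
  have "R field_differentiable at 0"
  proof -
    define r where "r = min 1 (Im z)"
    have r: "r > 0" using z by (simp add: r_def)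
    have nz: "theta w z \<noteq> 0" if "w \<in> ball 0 r - {0}" for w
    proof
      assume "theta w z = 0"
      then obtain m n :: int where mn: "w = of_int m + of_int n * z"
        using theta_eq_0_iff[OF z] by blast
      have "\<bar>of_int n\<bar> * Im z \<le> norm w"
        using abs_Im_le_cmod[of w] z by (simp add: mn abs_mult)
      also have "norm w < Im z" using that by (simp add: r_def)
      finally have "\<bar>of_int n :: real\<bar> < 1" using z by (simp add: mult_less_cancel_right2)
      hence n: "n = 0" by linarith
      hence "norm w = \<bar>of_int m\<bar>" by (simp add: mn)
      moreover have "norm w < 1" using that by (simp add: r_def)
      ultimately have "m = 0" by linarith
      with n mn that show False by simp
    qed
    have "R holomorphic_on ball 0 r"
    proof (rule no_isolated_singularity'[where K = "{0}"])
      show "R holomorphic_on ball 0 r - {0}"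
        using diff_off nz by (auto simp: holomorphic_on_def field_differentiable_at_within)
      fix c :: complex assume "c \<in> {0}"
      hence c: "c = 0" by simp
      have "theta 0 z = 0" by (subst theta_eq_0_iff[OF z]) (auto intro: exI[of _ 0])
      hence R0: "R 0 = D / T" by (simp add: R_def)
      \<comment> \<open>both \<open>h\<close> and theta have a zero at 0, so the quotient of the difference quotients has a limit\<close>
      have a: "((\<lambda>w. h w / w) \<longlongrightarrow> D) (at 0)"
        using deriv h0 by (simp add: has_field_derivative_iff)
      have b: "((\<lambda>w. theta w z / w) \<longlongrightarrow> T) (at 0)"
        using thT \<open>theta 0 z = 0\<close> by (simp add: has_field_derivative_iff)
      have lim: "((\<lambda>w. (h w / w) / (theta w z / w)) \<longlongrightarrow> D / T) (at 0)"
        by (rule tendsto_divide[OF a b T])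
      have ev: "eventually (\<lambda>w. (h w / w) / (theta w z / w) = R w) (at 0)"
      proof (rule eventually_mono[OF eventually_at_in_open[of "ball 0 r" 0]])
        fix w :: complex assume "w \<in> ball 0 r - {0}"
        with nz[OF this] show "(h w / w) / (theta w z / w) = R w" by (simp add: R_def)
      qed (use r in auto)
      have "(R \<longlongrightarrow> D / T) (at 0)"
        by (rule Lim_transform_eventually[OF lim ev])
      thus "(R \<longlongrightarrow> R c) (at c within ball 0 r)"
        unfolding c R0 by (rule tendsto_within_subset) auto
    qed auto
    thus ?thesis using r by (intro holomorphic_on_imp_differentiable_at[of _ "ball 0 r"]) auto
  qed
  hence diff: "R field_differentiable at w" for w
  proof (cases "theta w z = 0")
    case True
    then obtain m n :: int where mn: "w = of_int m + of_int n * z"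
      using theta_eq_0_iff[OF z] by blast
    have "R = R \<circ> (\<lambda>v. v - w)"
      using Ri[of "_ - w" m n] by (auto simp: mn fun_eq_iff algebra_simps)
    moreover have "(R \<circ> (\<lambda>v. v - w)) field_differentiable at w"
      by (intro field_differentiable_compose derivative_intros) (use \<open>R field_differentiable at 0\<close> in auto)
    ultimately show ?thesis by simp
  qed (use diff_off in auto)
  have Rhol: "R holomorphic_on UNIV"
    using diff by (auto simp: holomorphic_on_def)
  \<comment> \<open>a fundamental parallelogram: by periodicity it carries all values of \<open>R\<close>\<close>
  define K where "K = (\<lambda>(a, b). of_real a + of_real b * z) ` ({0..1::real} \<times> {0..1::real})"
  have "compact K"
    unfolding K_def case_prod_unfold
    by (intro compact_continuous_image compact_Times compact_Icc continuous_intros)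
  hence "compact (R ` K)"
    by (intro compact_continuous_image holomorphic_on_imp_continuous_on[OF holomorphic_on_subset[OF Rhol]]) auto
  moreover have "range R \<subseteq> R ` K"
  proof safe
    fix v :: complex
    define n where "n = \<lfloor>Im v / Im z\<rfloor>"
    define m where "m = \<lfloor>Re v - Im v / Im z * Re z\<rfloor>"
    define b where "b = Im v / Im z - of_int n"
    define a where "a = Re v - Im v / Im z * Re z - of_int m"
    have ab: "a \<in> {0..1}" "b \<in> {0..1}"
      unfolding a_def b_def n_def m_def by (simp_all, linarith+)
    have "v = (of_real a + of_real b * z) + of_int m + of_int n * z"
      using z by (intro complex_eqI) (simp_all add: a_def b_def field_simps)
    hence "R v = R (of_real a + of_real b * z)"
      using Ri by metis
    moreover have "of_real a + of_real b * z \<in> K"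
      using ab by (auto simp: K_def)
    ultimately show "R v \<in> R ` K" by blast
  qed
  ultimately have "bounded (range R)"
    using bounded_subset compact_imp_bounded by blast
  from Liouville_theorem[OF Rhol this] have "R w = R 0"
    by (auto simp: constant_on_def)
  moreover have "theta 0 z = 0"
    by (subst theta_eq_0_iff[OF z]) (auto intro: exI[of _ 0])
  ultimately have "h w / theta w z = D / T"
    using w by (simp add: R_def)
  thus ?thesis
    using w unfolding T_def by (simp add: nonzero_divide_eq_eq)
qed

section \<open>The inversion formula for eta\<close>

lemma dedekind_eta_qprod:
  "dedekind_eta z = exp (of_real pi * \<i> * z / 12) * qprod (ee z) (ee z)"
proof -
  have "exp (2 * of_real pi * \<i> * of_nat (Suc n) * z) = ee z * ee z ^ n" for n
    by (subst power_Suc [symmetric], subst ee_power) (simp add: ee_def mult_ac)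
  thus ?thesis
    by (simp only: dedekind_eta_def qprod_def)
qed

lemma norm_dedekind_eta:
  "norm (dedekind_eta z) = exp (- pi / 12 * Im z) * norm (qprod (ee z) (ee z))"
  by (simp add: dedekind_eta_qprod norm_mult)

lemma dedekind_eta_nonzero: "Im z > 0 \<Longrightarrow> dedekind_eta z \<noteq> 0"
  by (simp add: dedekind_eta_qprod qprod_self_nonzero)

text \<open>
  In absolute values no branch of a root has to be chosen. After multiplication by a
  Gaussian factor, \<open>theta (w / z) (- 1 / z)\<close> has the quasiperiods of \<open>theta w z\<close>, hence is \<open>C\<close> times
  it. The derivative at 0 gives \<open>C\<close> as a quotient of squares of eta products, while the product of
  the values at the three half periods is 2 for both theta functions and so gives \<open>C\<^sup>3\<close> explicitly.
\<close>

lemma dedekind_eta_S_norm: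
  assumes z: "Im z > 0"
  shows "norm (dedekind_eta (- 1 / z)) ^ 2 = norm z * norm (dedekind_eta z) ^ 2"
proof -
  define z' where "z' = - 1 / z"
  have z0: "z \<noteq> 0" using z by auto
  have zz': "z * z' = -1" using z0 by (simp add: z'_def)
  have "Im z' = Im z / (norm z)\<^sup>2"
    unfolding z'_def by (simp add: Im_divide cmod_power2)
  hence z': "Im z' > 0" using z z0 by simp
  define t where "t = (\<lambda>w. w\<^sup>2 * z' + w + w * z')"
  define h where "h = (\<lambda>w. exp (of_real pi * \<i> * t w) * theta (- (w * z')) z')"
  have shift: "theta (x - z') z' = - ee (x - z') * theta x z'" for x
    using theta_plus_period[OF z', of "x - z'"] by (simp add: ee_diff ee_minus field_simps)
  \<comment> \<open>the derivative of \<open>h\<close> at 0\<close>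
  define D where "D = - z' * (- 2 * of_real pi * \<i> * (qprod (ee z') (ee z'))\<^sup>2)"
  define C where "C = D / (- 2 * of_real pi * \<i> * (qprod (ee z) (ee z))\<^sup>2)"
  have hC: "h w = C * theta w z" if "theta w z \<noteq> 0" for w
    unfolding C_def
  proof (rule theta_quasiperiodic_unique[OF z _ _ _ _ _ that])
    show "h holomorphic_on UNIV"
    proof -
      have "((\<lambda>w. theta w z') \<circ> (\<lambda>w. - (w * z'))) holomorphic_on UNIV"
        by (intro holomorphic_on_compose theta_holomorphic z' holomorphic_intros)
      thus ?thesis
        unfolding h_def t_def o_def by (intro holomorphic_intros)
    qed
    fix w :: complex
    have "exp (of_real pi * \<i> * t (w + 1)) * ee (- (w * z') - z') =
            exp (of_real pi * \<i> * t w + of_real pi * \<i>)"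
      unfolding ee_def exp_add [symmetric] t_def
      by (rule arg_cong[where f = exp]) (simp add: algebra_simps power2_eq_square)
    also have "\<dots> = - exp (of_real pi * \<i> * t w)"
      by (simp add: exp_add)
    finally have e1: "exp (of_real pi * \<i> * t (w + 1)) * ee (- (w * z') - z') = - exp (of_real pi * \<i> * t w)" .
    have "- ((w + 1) * z') = - (w * z') - z'" by (simp add: algebra_simps)
    hence "h (w + 1) = - (exp (of_real pi * \<i> * t (w + 1)) * ee (- (w * z') - z')) * theta (- (w * z')) z'"
      by (simp add: h_def shift)
    thus "h (w + 1) = h w"
      by (simp only: e1 h_def) simp
    have "t (w + z) = t w + (2 * w * (z * z') + z * (z * z') + z + z * z')"
      by (simp add: t_def algebra_simps power2_eq_square)
    also have "\<dots> = t w - 2 * w - 1"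
      unfolding zz' by simp
    finally have tz: "t (w + z) = t w - 2 * w - 1" .
    have "exp (of_real pi * \<i> * t (w + z)) = exp (of_real pi * \<i> * t w + 2 * of_real pi * \<i> * (- w) - of_real pi * \<i>)"
      unfolding tz by (rule arg_cong[where f = exp]) (simp add: algebra_simps)
    also have "\<dots> = - (exp (of_real pi * \<i> * t w) * ee (- w))"
      by (simp add: exp_add exp_diff exp_minus ee_def divide_inverse)
    finally have e2: "exp (of_real pi * \<i> * t (w + z)) = - (exp (of_real pi * \<i> * t w) * ee (- w))" .
    have "- ((w + z) * z') = - (w * z') - z * z'" by (simp add: algebra_simps)
    hence "- ((w + z) * z') = - (w * z') + 1" by (simp add: zz')
    thus "h (w + z) = - ee (- w) * h w"
      by (simp only: h_def e2 theta_plus_1) simp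
  next
    have th0: "theta 0 z' = 0"
      by (subst theta_eq_0_iff[OF z']) (auto intro: exI[of _ 0])
    thus "h 0 = 0" by (simp add: h_def)
    have lin: "((\<lambda>w. - (w * z')) has_field_derivative - z') (at 0)"
      by (auto intro!: derivative_eq_intros)
    have th: "((\<lambda>w. theta (- (w * z')) z') has_field_derivative D) (at 0)"
      using DERIV_chain2[of "\<lambda>w. theta w z'", OF _ lin, of "- 2 * of_real pi * \<i> * (qprod (ee z') (ee z'))\<^sup>2"]
        theta_deriv_0[OF z'] by (simp add: D_def mult_ac)
    have "((\<lambda>w. exp (of_real pi * \<i> * t w)) has_field_derivative
            exp (of_real pi * \<i> * t 0) * (of_real pi * \<i> * (1 + z'))) (at 0)"
      unfolding t_def by (auto intro!: derivative_eq_intros)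
    from DERIV_mult[OF this th] show "(h has_field_derivative D) (at 0)"
      by (simp add: h_def t_def th0)
  qed
  \<comment> \<open>\<open>C\<^sup>3\<close> is found by comparing the products over the three half periods.\<close>
  have prod_z: "theta (1 / 2) z * theta (z / 2) z * theta ((z + 1) / 2) z = 2"
    and prod_z': "theta (1 / 2) z' * theta (z' / 2) z' * theta ((z' + 1) / 2) z' = 2"
    by (intro theta_half_periods z z')+
  hence nz: "theta (1 / 2) z \<noteq> 0" "theta (z / 2) z \<noteq> 0" "theta ((z + 1) / 2) z \<noteq> 0"
    by auto
  have arg: "- (1 / 2 * z') = z' / 2 - z'" "- (z / 2 * z') = 1 / 2"
    "- ((z + 1) / 2 * z') = (z' + 1) / 2 - z'"
    using zz' by (simp_all add: field_simps)
  have "t (1 / 2) + t (z / 2) + t ((z + 1) / 2) =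
          (z * (z * z')) / 2 + z * z' * 3 / 2 + z + 3 / 2 * z' + 1"
    by (simp add: t_def field_simps power2_eq_square)
  also have "\<dots> = z / 2 + 3 * z' / 2 - 1 / 2"
    unfolding zz' by (simp add: field_simps)
  finally have "t (1 / 2) + t (z / 2) + t ((z + 1) / 2) = z / 2 + 3 * z' / 2 - 1 / 2" .
  from arg_cong[OF this, of Im]
  have tsum: "Im (t (1 / 2)) + Im (t (z / 2)) + Im (t ((z + 1) / 2)) = Im z / 2 + 3 / 2 * Im z'"
    by simp
  have hh: "h (1 / 2) = exp (of_real pi * \<i> * t (1 / 2)) * (- ee (z' / 2 - z') * theta (z' / 2) z')"
    "h (z / 2) = exp (of_real pi * \<i> * t (z / 2)) * theta (1 / 2) z'"
    "h ((z + 1) / 2) = exp (of_real pi * \<i> * t ((z + 1) / 2)) * (- ee ((z' + 1) / 2 - z') * theta ((z' + 1) / 2) z')"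
    by (simp_all only: h_def arg shift)
  have ne: "norm (ee (z' / 2 - z')) = exp (pi * Im z')" "norm (ee ((z' + 1) / 2 - z')) = exp (pi * Im z')"
    by (simp_all add: norm_ee)
  have np: "norm (exp (of_real pi * \<i> * s)) = exp (- pi * Im s)" for s
    by simp
  have "C ^ 3 * 2 = (C * theta (1 / 2) z) * (C * theta (z / 2) z) * (C * theta ((z + 1) / 2) z)"
    by (subst prod_z [symmetric]) (simp only: power3_eq_cube mult_ac)
  also have "\<dots> = h (1 / 2) * h (z / 2) * h ((z + 1) / 2)"
    by (simp only: hC[OF nz(1)] hC[OF nz(2)] hC[OF nz(3)])
  finally have "norm (C ^ 3 * 2) = norm (h (1 / 2) * h (z / 2) * h ((z + 1) / 2))"
    by (rule arg_cong)
  also have "\<dots> = exp (- pi * Im (t (1 / 2))) * exp (- pi * Im (t (z / 2))) * exp (- pi * Im (t ((z + 1) / 2)))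
                  * exp (pi * Im z') * exp (pi * Im z')
                  * norm (theta (1 / 2) z' * theta (z' / 2) z' * theta ((z' + 1) / 2) z')"
    unfolding hh norm_mult norm_minus_cancel ne np by (simp only: mult_ac)
  also have "exp (- pi * Im (t (1 / 2))) * exp (- pi * Im (t (z / 2))) * exp (- pi * Im (t ((z + 1) / 2)))
               * exp (pi * Im z') * exp (pi * Im z') =
             exp (- pi * (Im (t (1 / 2)) + Im (t (z / 2)) + Im (t ((z + 1) / 2))) + 2 * pi * Im z')"
    unfolding exp_add [symmetric] by (rule arg_cong[where f = exp]) (simp add: algebra_simps)
  also have "\<dots> = exp (of_nat 3 * (pi / 6 * (Im z' - Im z)))"
    unfolding tsum by (rule arg_cong[where f = exp]) (simp add: algebra_simps)
  also have "\<dots> = exp (pi / 6 * (Im z' - Im z)) ^ 3"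
    by (rule exp_of_nat_mult)
  finally have "norm C ^ 3 = exp (pi / 6 * (Im z' - Im z)) ^ 3"
    unfolding prod_z' by (simp add: norm_mult norm_power)
  hence nC: "norm C = exp (pi / 6 * (Im z' - Im z))"
    using power_eq_imp_eq_base[of "norm C" 3 "exp (pi / 6 * (Im z' - Im z))"] by simp
  define E E' where "E = norm (qprod (ee z) (ee z))" and "E' = norm (qprod (ee z') (ee z'))"
  have E: "E > 0" using qprod_self_nonzero[OF z] by (simp add: E_def)
  have nz': "norm z' = 1 / norm z" by (simp add: z'_def norm_divide)
  have "norm C = norm z' * E' ^ 2 / E ^ 2"
    by (simp add: C_def D_def norm_mult norm_divide norm_power E_def E'_def)
  hence E'eq: "E' ^ 2 = norm z * E ^ 2 * exp (pi / 6 * (Im z' - Im z))"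
    using E z0 by (simp add: nC nz' field_simps)
  have "exp (pi / 6 * (Im z' - Im z)) * (exp (- pi / 12 * Im z'))\<^sup>2 = (exp (- pi / 12 * Im z))\<^sup>2"
    unfolding power2_eq_square exp_add [symmetric]
    by (rule arg_cong[where f = exp]) (simp add: field_simps)
  moreover have "(exp (- pi / 12 * Im z'))\<^sup>2 * E' ^ 2 =
      norm z * ((exp (pi / 6 * (Im z' - Im z)) * (exp (- pi / 12 * Im z'))\<^sup>2) * E ^ 2)"
    unfolding E'eq by (simp only: mult_ac)
  ultimately have "(exp (- pi / 12 * Im z'))\<^sup>2 * E' ^ 2 = norm z * ((exp (- pi / 12 * Im z))\<^sup>2 * E ^ 2)"
    by (simp only:)
  thus ?thesis
    by (simp only: norm_dedekind_eta z'_def [symmetric] E_def [symmetric] E'_def [symmetric] power_mult_distrib)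
qed

section \<open>Invariance under the modular group\<close>

lemma denominator_nonzero:
  assumes "a * d - b * c = (1::int)" "Im z > 0"
  shows "of_int c * z + of_int d \<noteq> 0"
proof
  assume *: "of_int c * z + of_int d = 0"
  hence "Im (of_int c * z + of_int d) = 0" by simp
  hence "c = 0" using assms(2) by simp
  with * assms(1) show False by simp
qed

lemma Im_moebius:
  assumes "a * d - b * c = (1::int)"
  shows "Im ((of_int a * z + of_int b) / (of_int c * z + of_int d)) = Im z / (norm (of_int c * z + of_int d))\<^sup>2"
proof -
  have "real_of_int a * of_int d - of_int b * of_int c = 1"
    using assms by (metis of_int_1 of_int_diff of_int_mult)
  hence ad: "real_of_int a * of_int d = 1 + of_int b * of_int c" by simp
  have "Im (of_int a * z + of_int b) * Re (of_int c * z + of_int d) - Re (of_int a * z + of_int b) * Im (of_int c * z + of_int d) =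
        (of_int a * of_int d) * Im z - of_int b * of_int c * Im z"
    by (simp add: algebra_simps)
  also have "\<dots> = Im z" unfolding ad by (simp add: algebra_simps)
  finally show ?thesis
    by (simp add: Im_divide cmod_power2)
qed

text \<open>
  The fourth power is taken so that the weight cancels: \<open>Im z\<close> has weight \<open>-2\<close> in absolute value and
  eta has weight \<open>1/2\<close>.
\<close>

definition eta_invariant :: "complex \<Rightarrow> real" where
  "eta_invariant z = Im z * norm (dedekind_eta z) ^ 4"

lemma eta_invariant_translate: "eta_invariant (z + of_int n) = eta_invariant z"
  by (simp add: eta_invariant_def norm_dedekind_eta ee_add)

lemma eta_invariant_S:
  assumes "Im z > 0"
  shows "eta_invariant (- 1 / z) = eta_invariant z"
proof -
  have "z \<noteq> 0" using assms by auto
  have "norm (dedekind_eta (- 1 / z)) ^ 4 = (norm (dedekind_eta (- 1 / z)) ^ 2) ^ 2" by simp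
  also have "\<dots> = (norm z)\<^sup>2 * norm (dedekind_eta z) ^ 4"
    unfolding dedekind_eta_S_norm[OF assms] by (simp add: power_mult_distrib)
  finally show ?thesis
    using Im_moebius[of 0 0 "-1" 1 z] \<open>z \<noteq> 0\<close> by (simp add: eta_invariant_def)
qed

text \<open>
  The Euclidean algorithm on the bottom-left entry, each division step of which is a translation
  followed by the inversion.
\<close>

lemma eta_invariant_moebius:
  assumes "a * d - b * c = (1::int)" and z: "Im z > 0"
  shows "eta_invariant ((of_int a * z + of_int b) / (of_int c * z + of_int d)) = eta_invariant z"
  using assms(1)
proof (induction "nat \<bar>c\<bar>" arbitrary: a b c d rule: less_induct)
  case less
  show ?case
  proof (cases "c = 0")
    case True
    hence "a = 1 \<and> d = 1 \<or> a = -1 \<and> d = -1"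
      using less.prems by (auto simp: zmult_eq_1_iff)
    hence "(of_int a * z + of_int b) / (of_int c * z + of_int d) = z + of_int (a * b)"
      using True by auto
    thus ?thesis by (simp only: eta_invariant_translate)
  next
    case False
    define k where "k = a div c"
    define v where "v = (of_int (a - k * c) * z + of_int (b - k * d)) / (of_int c * z + of_int d)"
    have nz: "of_int c * z + of_int d \<noteq> 0"
      by (rule denominator_nonzero[OF less.prems z])
    have det: "(a - k * c) * d - (b - k * d) * c = 1"
      using less.prems by (simp add: algebra_simps)
    have v: "Im v > 0"
      unfolding v_def Im_moebius[OF det] using z nz by simp
    have "a - k * c = a mod c" by (simp add: k_def minus_div_mult_eq_mod)
    hence "nat \<bar>a - k * c\<bar> < nat \<bar>c\<bar>"
      using False by (simp add: abs_mod_less)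
    hence "eta_invariant ((of_int (- c) * z + of_int (- d)) / (of_int (a - k * c) * z + of_int (b - k * d))) = eta_invariant z"
      by (rule less.hyps) (use less.prems in \<open>simp add: algebra_simps\<close>)
    also have "(of_int (- c) * z + of_int (- d)) / (of_int (a - k * c) * z + of_int (b - k * d)) = - 1 / v"
      by (simp add: v_def divide_simps)
    finally have "eta_invariant v = eta_invariant z"
      by (simp only: eta_invariant_S[OF v])
    moreover have "(of_int a * z + of_int b) / (of_int c * z + of_int d) = v + of_int k"
      unfolding v_def using nz by (simp add: field_simps)
    ultimately show ?thesis by (simp only: eta_invariant_translate)
  qed
qed

text \<open>
  The matrix \<open>(d 0; 0 1) (a b; c e)\<close> of determinant \<open>d\<close> factors as an element of \<open>SL(2, \<int>)\<close> times an
  upper triangular matrix with diagonal \<open>g, d / g\<close>, where \<open>g = gcd c d\<close>. This is where the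
  numbers \<open>gcd(c, d)\<^sup>2 / d\<close> in the order at a cusp come from.
\<close>

lemma eta_invariant_dilate_moebius:
  fixes d :: nat
  assumes det: "a * e - b * c = (1::int)" and d: "d > 0"
  obtains B :: int where
    "\<And>z. Im z > 0 \<Longrightarrow>
       eta_invariant (of_nat d * ((of_int a * z + of_int b) / (of_int c * z + of_int e))) =
       eta_invariant ((of_int (gcd c (int d)) * z + of_int B) / (of_nat d / of_int (gcd c (int d))))"
proof -
  define g where "g = gcd c (int d)"
  have g: "g > 0" using d by (simp add: g_def)
  obtain D where D: "int d = g * D" using gcd_dvd2[of c "int d"] unfolding g_def by (elim dvdE)
  obtain c' where c': "c = g * c'" using gcd_dvd1[of c "int d"] unfolding g_def by (elim dvdE)
  have "D \<noteq> 0" using D d by auto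
  have "coprime c' D"
  proof -
    have "g = gcd (g * c') (g * D)" using g_def D c' by simp
    also have "\<dots> = g * gcd c' D" using g by (simp add: gcd_mult_distrib_int [symmetric])
    finally show ?thesis using g by (simp add: coprime_iff_gcd_eq_1)
  qed
  moreover have "coprime a c'"
  proof (rule coprimeI)
    fix l assume "l dvd a" "l dvd c'"
    hence "l dvd a * e - b * c" unfolding c' by (intro dvd_diff) auto
    thus "l dvd 1" using det by simp
  qed
  ultimately have "coprime (D * a) c'"
    by (simp add: coprime_commute)
  then obtain u v where uv: "u * (D * a) + v * c' = 1"
    using bezout_int[of "D * a" c'] by auto
  define B where "B = u * int d * b + v * e"
  have det': "(D * a) * u - (- v) * c' = 1" using uv by (simp add: algebra_simps)
  have Deq: "D = D * a * e - c' * int d * b"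
  proof -
    have "D = D * (a * e - b * c)" using det by simp
    also have "\<dots> = D * a * e - c' * int d * b" unfolding D c' by (simp add: algebra_simps)
    finally show ?thesis .
  qed
  have i1: "D * a * B - v * D = int d * b"
  proof -
    have "D * a * B - v * D = D * a * B - v * (D * a * e - c' * int d * b)" using Deq by simp
    also have "\<dots> = (u * (D * a) + v * c') * (int d * b)" by (simp add: B_def algebra_simps)
    finally show ?thesis using uv by simp
  qed
  have i2: "c' * B + u * D = e"
  proof -
    have "c' * B + u * D = c' * B + u * (D * a * e - c' * int d * b)" using Deq by simp
    also have "\<dots> = (u * (D * a) + v * c') * e" by (simp add: B_def algebra_simps)
    finally show ?thesis using uv by simp
  qed
  show ?thesis
  proof (rule that)
    fix z :: complex assume z: "Im z > 0"
    define w where "w = (of_int g * z + of_int B) / of_int D"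
    have DD: "(of_int D :: complex) \<noteq> 0" using \<open>D \<noteq> 0\<close> by simp
    have DDg: "of_nat d / of_int g = (of_int D :: complex)"
    proof -
      have "(of_nat d :: complex) = of_int (g * D)" using D by (metis of_int_of_nat_eq)
      thus ?thesis using g by simp
    qed
    have "D > 0" using D d g by (metis of_nat_0_less_iff zero_less_mult_pos)
    have "w * of_int D = of_int g * z + of_int B"
      using DD by (simp add: w_def)
    from arg_cong[OF this, of Im] have "Im w * of_int D = of_int g * Im z"
      by simp
    hence w: "Im w > 0"
      using z g \<open>D > 0\<close> by (metis mult_pos_pos of_int_0_less_iff zero_less_mult_pos2)
    have n1: "of_int (D * a) * w + of_int (- v) = (of_nat d * (of_int a * z + of_int b)) / of_int D"
    proof -
      have "(of_int (D * a) * w + of_int (- v)) * of_int D = of_int (D * a * g) * z + of_int (D * a * B - v * D)"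
        using DD by (simp add: w_def field_simps)
      also have "D * a * g = int d * a" by (simp add: D)
      finally show ?thesis unfolding i1 using DD by (simp add: field_simps)
    qed
    have n2: "of_int c' * w + of_int u = (of_int c * z + of_int e) / of_int D"
    proof -
      have "(of_int c' * w + of_int u) * of_int D = of_int (c' * g) * z + of_int (c' * B + u * D)"
        using DD by (simp add: w_def field_simps)
      also have "c' * g = c" by (simp add: c')
      finally show ?thesis unfolding i2 using DD by (simp add: field_simps)
    qed
    have "eta_invariant ((of_int (D * a) * w + of_int (- v)) / (of_int c' * w + of_int u)) = eta_invariant w"
      by (rule eta_invariant_moebius[OF det' w])
    thus "eta_invariant (of_nat d * ((of_int a * z + of_int b) / (of_int c * z + of_int e))) =
            eta_invariant ((of_int (gcd c (int d)) * z + of_int B) / (of_nat d / of_int (gcd c (int d))))"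
      unfolding n1 n2 g_def [symmetric] DDg w_def [symmetric] using DD by simp
  qed
qed

section \<open>Growth of eta quotients at the cusps\<close>

lemma ln_power_int:
  assumes "x > (0::real)"
  shows "ln (x powi n) = of_int n * ln x"
  using assms by (cases n rule: int_cases4) (auto simp: power_int_minus ln_inverse ln_realpow)

lemma ln_norm_dedekind_eta_bounds:
  assumes "Im w \<ge> 1"
  shows "\<bar>ln (norm (dedekind_eta w)) + pi / 12 * Im w\<bar> \<le> 1"
proof -
  have "norm (ee w) \<le> exp (-2)"
    using assms pi_gt3 mult_mono[of 1 pi 1 "Im w"] by (simp add: norm_ee)
  also have "exp (-2 :: real) \<le> 1 / 4"
  proof -
    have "4 \<le> exp (1::real) * exp 1"
      using exp_ge_add_one_self[of "1::real"] mult_mono[of 2 "exp (1::real)" 2 "exp 1"] by simp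
    also have "\<dots> = exp 2" by (simp add: exp_add [symmetric])
    finally show ?thesis by (simp add: exp_minus field_simps)
  qed
  finally have q: "norm (ee w) \<le> 1 / 4" .
  define E where "E = norm (qprod (ee w) (ee w))"
  have E: "2 / 3 \<le> E" "E \<le> 2"
    unfolding E_def by (rule qprod_norm_bounds[OF q])+
  have "ln (norm (dedekind_eta w)) + pi / 12 * Im w = ln E"
    using E by (simp add: norm_dedekind_eta E_def [symmetric] ln_mult)
  moreover have "\<bar>ln E\<bar> \<le> 1"
  proof -
    have "ln E \<le> E - 1" using E by (intro ln_le_minus_one) simp
    moreover have "- ln E = ln (1 / E)" using E by (simp add: ln_div)
    moreover have "ln (1 / E) \<le> 1 / E - 1" using E by (intro ln_le_minus_one) simp
    moreover have "1 / E \<le> 3 / 2" using E by (simp add: field_simps)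
    ultimately show ?thesis using E by simp
  qed
  ultimately show ?thesis by simp
qed

lemma dedekind_eta_growth_at_cusp:
  fixes d :: nat
  assumes det: "a * e - b * c = (1::int)" and d: "d > 0"
  obtains K Y where "Y \<ge> 1"
    "\<And>z. Im z \<ge> Y \<Longrightarrow>
      \<bar>ln (norm (dedekind_eta (of_nat d * ((of_int a * z + of_int b) / (of_int c * z + of_int e)))))
        - ln (norm (of_int c * z + of_int e)) / 2
        + pi / 12 * (of_nat (gcd (nat \<bar>c\<bar>) d) ^ 2 / of_nat d) * Im z\<bar> \<le> K"
proof -
  define g :: real where "g = of_nat (gcd (nat \<bar>c\<bar>) d)"
  have g: "g > 0" using d by (simp add: g_def)
  have gc: "complex_of_int (gcd c (int d)) = of_real g"
  proof -
    have "gcd c (int d) = int (gcd (nat \<bar>c\<bar>) d)"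
      by (metis gcd_abs1_int gcd_int_int_eq nat_0_le abs_ge_zero)
    thus ?thesis by (simp add: g_def)
  qed
  obtain B :: int where B: "\<And>z. Im z > 0 \<Longrightarrow>
       eta_invariant (of_nat d * ((of_int a * z + of_int b) / (of_int c * z + of_int e))) =
       eta_invariant ((of_real g * z + of_int B) / (of_nat d / of_real g))"
    using eta_invariant_dilate_moebius[OF det d] unfolding gc by blast
  \<comment> \<open>from this height on, the transformed point has imaginary part at least 1\<close>
  define Y where "Y = max 1 (d / g ^ 2)"
  show ?thesis
  proof (rule that)
    show "Y \<ge> 1" by (simp add: Y_def)
    fix z assume "Im z \<ge> Y"
    hence z: "Im z > 0" "Im z \<ge> d / g ^ 2" by (auto simp: Y_def)
    define w where "w = (of_real g * z + of_int B) / (of_nat d / of_real g)"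
    define v where "v = of_nat d * ((of_int a * z + of_int b) / (of_int c * z + of_int e))"
    define j where "j = norm (of_int c * z + of_int e)"
    have j: "j > 0"
      using denominator_nonzero[OF det z(1)] by (simp add: j_def)
    have Imw: "Im w = g ^ 2 / d * Im z"
    proof -
      have "w = (of_real g * z + of_int B) * of_real (g / d)"
        by (simp add: w_def)
      also have "Im \<dots> = g * Im z * (g / d)"
        by simp
      finally show ?thesis by (simp add: power2_eq_square)
    qed
    have w1: "Im w \<ge> 1"
      unfolding Imw using z(2) g d by (simp add: field_simps)
    have Imv: "Im v = d * (Im z / j ^ 2)"
    proof -
      have "Im (of_nat d * u) = d * Im u" for u by simp
      thus ?thesis by (simp only: v_def j_def Im_moebius[OF det])
    qed
    have v: "Im v > 0" unfolding Imv using z d j by simp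
    have nv: "norm (dedekind_eta v) > 0" and nw: "norm (dedekind_eta w) > 0"
      using dedekind_eta_nonzero v w1 by auto
    have "Im v * norm (dedekind_eta v) ^ 4 = Im w * norm (dedekind_eta w) ^ 4"
      using B[OF z(1)] by (simp only: v_def w_def eta_invariant_def)
    hence "ln (Im v * norm (dedekind_eta v) ^ 4) = ln (Im w * norm (dedekind_eta w) ^ 4)"
      by simp
    hence "ln (Im v) + 4 * ln (norm (dedekind_eta v)) = ln (Im w) + 4 * ln (norm (dedekind_eta w))"
      using nv nw v w1 by (simp add: ln_mult ln_realpow)
    moreover have "ln (Im v) = ln d + ln (Im z) - 2 * ln j"
      unfolding Imv using z d j by (simp add: ln_mult ln_div ln_realpow)
    moreover have "ln (Im w) = 2 * ln g - ln d + ln (Im z)"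
      unfolding Imw using z d g by (simp add: ln_mult ln_div ln_realpow)
    ultimately have "ln (norm (dedekind_eta v)) = (ln g - ln d) / 2 + ln j / 2 + ln (norm (dedekind_eta w))"
      by (simp add: field_simps)
    hence "ln (norm (dedekind_eta v)) - ln j / 2 + pi / 12 * (g ^ 2 / d) * Im z =
             (ln g - ln d) / 2 + (ln (norm (dedekind_eta w)) + pi / 12 * Im w)"
      by (simp add: Imw)
    also have "\<bar>\<dots>\<bar> \<le> \<bar>(ln g - ln d) / 2\<bar> + 1"
      using ln_norm_dedekind_eta_bounds[OF w1] by linarith
    finally show "\<bar>ln (norm (dedekind_eta (of_nat d * ((of_int a * z + of_int b) / (of_int c * z + of_int e)))))
        - ln (norm (of_int c * z + of_int e)) / 2
        + pi / 12 * (of_nat (gcd (nat \<bar>c\<bar>) d) ^ 2 / of_nat d) * Im z\<bar> \<le> \<bar>(ln g - ln d) / 2\<bar> + 1"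
      by (simp only: v_def j_def g_def)
  qed
qed

text \<open>
  The order at the cusps \<open>a / c\<close>, up to the factor \<open>1 / 24\<close> and the width of the cusp. It makes
  sense for all \<open>c\<close>, where \<open>c = 0\<close> is the cusp at infinity.
\<close>

definition cusp_order :: "(nat \<Rightarrow> int) \<Rightarrow> nat \<Rightarrow> real" where
  "cusp_order X c = (\<Sum>d | X d \<noteq> 0. of_nat (gcd c d) ^ 2 / of_nat d * of_int (X d))"

text \<open>
  The logarithmic form keeps the two sources of growth additive: the automorphy factor, which is
  compensated by the slash operator, and the exponential term, whose rate is the order at the cusp.
\<close>

lemma eta_quotient_ln_growth_at_cusp:
  assumes X: "eta_exponents X" and det: "a * e - b * c = (1::int)"
  obtains K Y where "Y \<ge> 1"
    "\<And>z. Im z \<ge> Y \<Longrightarrow>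
      eta_quotient X ((of_int a * z + of_int b) / (of_int c * z + of_int e)) \<noteq> 0 \<and>
      \<bar>ln (norm (eta_quotient X ((of_int a * z + of_int b) / (of_int c * z + of_int e))))
        - (\<Sum>d | X d \<noteq> 0. of_int (X d)) / 2 * ln (norm (of_int c * z + of_int e))
        + pi / 12 * cusp_order X (nat \<bar>c\<bar>) * Im z\<bar> \<le> K"
proof -
  define S where "S = {d. X d \<noteq> 0}"
  have fin: "finite S" and pos: "\<And>d. d \<in> S \<Longrightarrow> d > 0"
    using X by (auto simp: eta_exponents_def S_def intro: Nat.gr0I)
  define G where "G = (\<lambda>d z. ln (norm (dedekind_eta (of_nat d * ((of_int a * z + of_int b) / (of_int c * z + of_int e)))))
        - ln (norm (of_int c * z + of_int e)) / 2
        + pi / 12 * (of_nat (gcd (nat \<bar>c\<bar>) d) ^ 2 / of_nat d) * Im z)"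
  have "\<exists>K Y. \<forall>z. Im z \<ge> Y \<longrightarrow> \<bar>G d z\<bar> \<le> K" if "d \<in> S" for d
    using dedekind_eta_growth_at_cusp[OF det pos[OF that]] unfolding G_def by metis
  then obtain K Y where KY: "\<And>d z. d \<in> S \<Longrightarrow> Im z \<ge> Y d \<Longrightarrow> \<bar>G d z\<bar> \<le> K d"
    by metis
  define Ym where "Ym = Max (insert 1 (Y ` S))"
  have Ym: "Ym \<ge> 1" "\<And>d. d \<in> S \<Longrightarrow> Y d \<le> Ym"
    using fin by (auto simp: Ym_def)
  show ?thesis
  proof (rule that[OF Ym(1)])
    fix z assume "Im z \<ge> Ym"
    hence z: "Im z > 0" "\<And>d. d \<in> S \<Longrightarrow> Im z \<ge> Y d"
      using Ym by fastforce+
    define v where "v = (of_int a * z + of_int b) / (of_int c * z + of_int e)"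
    have v: "Im v > 0"
      unfolding v_def Im_moebius[OF det] using z denominator_nonzero[OF det z(1)] by simp
    have nz: "dedekind_eta (of_nat d * v) \<noteq> 0" if "d \<in> S" for d
      using pos[OF that] v by (intro dedekind_eta_nonzero) simp
    have f: "eta_quotient X v = (\<Prod>d\<in>S. dedekind_eta (of_nat d * v) powi X d)"
      using v by (simp add: eta_quotient_def S_def upper_half_plane_def)
    have nzf: "eta_quotient X v \<noteq> 0"
      unfolding f using nz fin by simp
    have "ln (norm (eta_quotient X v)) = (\<Sum>d\<in>S. of_int (X d) * ln (norm (dedekind_eta (of_nat d * v))))"
    proof -
      have "ln (norm (eta_quotient X v)) = ln (\<Prod>d\<in>S. norm (dedekind_eta (of_nat d * v)) powi X d)"
        unfolding f by (simp add: prod_norm [symmetric] norm_power_int)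
      also have "\<dots> = (\<Sum>d\<in>S. ln (norm (dedekind_eta (of_nat d * v)) powi X d))"
        using nz fin by (intro ln_prod) auto
      also have "\<dots> = (\<Sum>d\<in>S. of_int (X d) * ln (norm (dedekind_eta (of_nat d * v))))"
        using nz by (intro sum.cong refl) (simp add: ln_power_int)
      finally show ?thesis .
    qed
    hence "ln (norm (eta_quotient X v))
        - (\<Sum>d\<in>S. of_int (X d)) / 2 * ln (norm (of_int c * z + of_int e))
        + pi / 12 * cusp_order X (nat \<bar>c\<bar>) * Im z = (\<Sum>d\<in>S. of_int (X d) * G d z)"
      by (simp add: G_def cusp_order_def S_def [symmetric] v_def sum_distrib_left sum_distrib_right
            sum_divide_distrib sum.distrib sum_subtractf algebra_simps)
    also have "\<bar>\<dots>\<bar> \<le> (\<Sum>d\<in>S. \<bar>of_int (X d) * G d z\<bar>)"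
      by (rule sum_abs)
    also have "\<dots> \<le> (\<Sum>d\<in>S. \<bar>of_int (X d)\<bar> * K d)"
      using KY z(2) by (intro sum_mono) (auto simp: abs_mult intro!: mult_left_mono)
    finally show "eta_quotient X ((of_int a * z + of_int b) / (of_int c * z + of_int e)) \<noteq> 0 \<and>
      \<bar>ln (norm (eta_quotient X ((of_int a * z + of_int b) / (of_int c * z + of_int e))))
        - (\<Sum>d | X d \<noteq> 0. of_int (X d)) / 2 * ln (norm (of_int c * z + of_int e))
        + pi / 12 * cusp_order X (nat \<bar>c\<bar>) * Im z\<bar> \<le> (\<Sum>d\<in>S. \<bar>of_int (X d)\<bar> * K d)"
      using nzf unfolding v_def S_def by blast
  qed
qed

section \<open>Exponents are determined by the orders at the cusps\<close>

text \<open>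
  Jordan's totient \<open>J\<^sub>2\<close>, in the form of the Dirichlet convolution of \<open>d \<phi>(d)\<close> with \<open>\<phi>\<close>, which
  makes positivity obvious.
\<close>

definition jordan2 :: "nat \<Rightarrow> nat" where
  "jordan2 n = (\<Sum>d | d dvd n. d * totient d * totient (n div d))"

lemma jordan2_pos: "n > 0 \<Longrightarrow> jordan2 n > 0"
  unfolding jordan2_def by (intro sum_pos2[of _ n]) auto

text \<open>
  Since \<open>\<phi> * 1 = id\<close>, one gets \<open>J\<^sub>2 * 1 = (id \<cdot> \<phi>) * id = id \<cdot> (\<phi> * 1) = id\<^sup>2\<close>.
\<close>

lemma sum_jordan2:
  assumes "n > 0"
  shows "(\<Sum>e | e dvd n. jordan2 e) = n ^ 2"
proof -
  have "(\<Sum>e | e dvd n. jordan2 e) =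
          (\<Sum>(e, d) \<in> (SIGMA e:{e. e dvd n}. {d. d dvd e}). d * totient d * totient (e div d))"
    unfolding jordan2_def
    using assms by (intro sum.Sigma) (auto intro: finite_divisors_nat dvd_pos_nat)
  also have "\<dots> = (\<Sum>(d, k) \<in> (SIGMA d:{d. d dvd n}. {k. k dvd n div d}). d * totient d * totient k)"
    using assms
    by (intro sum.reindex_bij_witness[of _ "\<lambda>(d, k). (d * k, d)" "\<lambda>(e, d). (d, e div d)"])
       (auto simp: dvd_div_iff_mult div_dvd_div dvd_mult_div_cancel intro: dvd_trans dvd_pos_nat)
  also have "\<dots> = (\<Sum>d | d dvd n. \<Sum>k | k dvd n div d. d * totient d * totient k)"
    using assms by (intro sum.Sigma [symmetric]) (auto intro!: finite_divisors_nat elim!: dvdE)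
  also have "\<dots> = (\<Sum>d | d dvd n. n * totient d)"
  proof (intro sum.cong refl)
    fix d assume "d \<in> {d. d dvd n}"
    hence "d dvd n" by simp
    have "(\<Sum>k | k dvd n div d. d * totient d * totient k) = d * totient d * (\<Sum>k | k dvd n div d. totient k)"
      by (simp add: sum_distrib_left)
    also have "\<dots> = n * totient d"
      using \<open>d dvd n\<close> by (simp add: totient_divisor_sum)
    finally show "(\<Sum>k | k dvd n div d. d * totient d * totient k) = n * totient d" .
  qed
  also have "\<dots> = n ^ 2"
    by (simp add: sum_distrib_left [symmetric] totient_divisor_sum power2_eq_square)
  finally show ?thesis .
qed

lemma cusp_order_superset:
  assumes "finite S" "{d. X d \<noteq> 0} \<subseteq> S"
  shows "cusp_order X c = (\<Sum>d\<in>S. of_nat (gcd c d) ^ 2 / of_nat d * of_int (X d))"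
  unfolding cusp_order_def using assms by (intro sum.mono_neutral_left) auto

text \<open>
  By \<open>gcd(c, d)\<^sup>2 = \<Sum> J\<^sub>2(e)\<close>, summed over the common divisors \<open>e\<close>, the order at \<open>c\<close> is the sum of
  \<open>J\<^sub>2(e) T(e)\<close> over \<open>e dvd c\<close> with \<open>T(e)\<close> the sum of \<open>X\<^sub>d / d\<close> over the multiples \<open>d\<close> of \<open>e\<close>. Both
  triangular systems can be inverted.
\<close>

lemma cusp_order_zero_imp_zero:
  assumes X: "eta_exponents X" and 0: "\<And>c. cusp_order X c = 0"
  shows "X = (\<lambda>_. 0)"
proof (rule ccontr)
  assume "X \<noteq> (\<lambda>_. 0)"
  define S where "S = {d. X d \<noteq> 0}"
  have S: "finite S" "S \<noteq> {}" "0 \<notin> S"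
    using X \<open>X \<noteq> _\<close> by (auto simp: S_def eta_exponents_def)
  define T where "T = (\<lambda>e. \<Sum>d\<in>S. if e dvd d then of_int (X d) / of_nat d else (0::real))"
  have order: "cusp_order X c = (\<Sum>e | e dvd c. of_nat (jordan2 e) * T e)" if "c > 0" for c
  proof -
    have fin: "finite {e. e dvd c}" using that by (simp add: finite_divisors_nat)
    have "cusp_order X c = (\<Sum>d\<in>S. \<Sum>e | e dvd c. if e dvd d then of_nat (jordan2 e) * (of_int (X d) / of_nat d) else 0)"
      unfolding cusp_order_def S_def [symmetric]
    proof (intro sum.cong refl)
      fix d
      have "real (gcd c d) ^ 2 = of_nat (\<Sum>e | e dvd gcd c d. jordan2 e)"
        using that by (subst sum_jordan2) auto
      also have "\<dots> = (\<Sum>e | e dvd c \<and> e dvd d. of_nat (jordan2 e))"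
        by simp
      finally have "real (gcd c d) ^ 2 / of_nat d * of_int (X d) =
          (\<Sum>e | e dvd c \<and> e dvd d. of_nat (jordan2 e) * (of_int (X d) / of_nat d))"
        by (simp add: sum_distrib_right sum_divide_distrib)
      also have "\<dots> = (\<Sum>e | e dvd c. if e dvd d then of_nat (jordan2 e) * (of_int (X d) / of_nat d) else 0)"
        using fin by (simp add: sum.inter_filter [symmetric])
      finally show "real (gcd c d) ^ 2 / of_nat d * of_int (X d) = \<dots>" .
    qed
    also have "\<dots> = (\<Sum>e | e dvd c. \<Sum>d\<in>S. if e dvd d then of_nat (jordan2 e) * (of_int (X d) / of_nat d) else 0)"
      by (rule sum.swap)
    also have "\<dots> = (\<Sum>e | e dvd c. of_nat (jordan2 e) * T e)"
      unfolding T_def sum_distrib_left by (intro sum.cong refl) auto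
    finally show ?thesis .
  qed
  have T0: "T c = 0" if "c > 0" for c
    using that
  proof (induction c rule: less_induct)
    case (less c)
    have fin: "finite {e. e dvd c}" using less.prems by (simp add: finite_divisors_nat)
    have "0 = (\<Sum>e | e dvd c. of_nat (jordan2 e) * T e)"
      using order[OF less.prems] 0 by simp
    also have "\<dots> = of_nat (jordan2 c) * T c + (\<Sum>e \<in> {e. e dvd c} - {c}. of_nat (jordan2 e) * T e)"
      using fin by (subst sum.remove[of _ c]) auto
    also have "(\<Sum>e \<in> {e. e dvd c} - {c}. of_nat (jordan2 e) * T e) = 0"
    proof (intro sum.neutral ballI)
      fix e assume "e \<in> {e. e dvd c} - {c}"
      hence "e < c" "e > 0" using less.prems by (auto intro: dvd_pos_nat dest: dvd_imp_le)
      thus "of_nat (jordan2 e) * T e = 0" using less.IH by simp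
    qed
    finally show "T c = 0" using jordan2_pos[OF less.prems] by simp
  qed
  define m where "m = Max S"
  have m: "m \<in> S" "\<And>d. d \<in> S \<Longrightarrow> d \<le> m" using S by (auto simp: m_def)
  hence "m > 0" using S(3) by (cases m) auto
  have "d = m" if "d \<in> S" "m dvd d" for d
    using that m(2)[OF that(1)] S(3) by (metis dvd_imp_le le_antisym neq0_conv)
  hence "T m = (\<Sum>d\<in>S. if d = m then of_int (X d) / of_nat d else 0)"
    unfolding T_def by (intro sum.cong refl) auto
  also have "\<dots> = of_int (X m) / of_nat m"
    using S(1) m(1) by simp
  finally show False
    using T0[OF \<open>m > 0\<close>] m(1) \<open>m > 0\<close> by (simp add: S_def)
qed

section \<open>Eta quotients and their exponents\<close>

lemma eta_quotient_superset:
  assumes "Im z > 0" "finite S" "{d. X d \<noteq> 0} \<subseteq> S"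
  shows "eta_quotient X z = (\<Prod>d\<in>S. dedekind_eta (of_nat d * z) powi X d)"
proof -
  have "(\<Prod>d | X d \<noteq> 0. dedekind_eta (of_nat d * z) powi X d) = (\<Prod>d\<in>S. dedekind_eta (of_nat d * z) powi X d)"
    using assms by (intro prod.mono_neutral_left) auto
  thus ?thesis using assms(1) by (simp add: eta_quotient_def upper_half_plane_def)
qed

lemma eta_exponents_add:
  assumes "eta_exponents X" "eta_exponents Y"
  shows "eta_exponents (\<lambda>d. X d + Y d)"
proof -
  have "{d. X d + Y d \<noteq> 0} \<subseteq> {d. X d \<noteq> 0} \<union> {d. Y d \<noteq> 0}" by auto
  thus ?thesis
    using assms by (auto simp: eta_exponents_def intro: finite_subset)
qed

lemma eta_exponents_diff:
  assumes "eta_exponents X" "eta_exponents Y"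
  shows "eta_exponents (\<lambda>d. X d - Y d)"
  using eta_exponents_add[of X "\<lambda>d. - Y d"] assms by (simp add: eta_exponents_def)

lemma eta_quotient_add:
  assumes X: "eta_exponents X" and Y: "eta_exponents Y" and z: "Im z > 0"
  shows "eta_quotient (\<lambda>d. X d + Y d) z = eta_quotient X z * eta_quotient Y z"
proof -
  define S where "S = {d. X d \<noteq> 0} \<union> {d. Y d \<noteq> 0}"
  have S: "finite S" "{d. X d \<noteq> 0} \<subseteq> S" "{d. Y d \<noteq> 0} \<subseteq> S" "{d. X d + Y d \<noteq> 0} \<subseteq> S"
    and "0 \<notin> S"
    using X Y by (auto simp: S_def eta_exponents_def)
  have "dedekind_eta (of_nat d * z) \<noteq> 0" if "d \<in> S" for d
    using that \<open>0 \<notin> S\<close> z by (intro dedekind_eta_nonzero) (cases "d = 0", auto)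
  thus ?thesis
    using eta_quotient_superset[OF z S(1)] S
    by (simp add: power_int_add prod.distrib [symmetric])
qed

lemma eta_quotient_nonzero:
  assumes "eta_exponents X" "Im z > 0"
  shows "eta_quotient X z \<noteq> 0"
proof -
  have "dedekind_eta (of_nat d * z) \<noteq> 0" if "X d \<noteq> 0" for d
    using that assms by (intro dedekind_eta_nonzero) (cases "d = 0", auto simp: eta_exponents_def)
  thus ?thesis
    using assms by (auto simp: eta_quotient_def upper_half_plane_def eta_exponents_def)
qed

lemma eta_quotient_zero: "Im z > 0 \<Longrightarrow> eta_quotient (\<lambda>_. 0) z = 1"
  by (simp add: eta_quotient_def upper_half_plane_def)

text \<open>
  Along the imaginary axis the automorphy factor grows only like a power of \<open>y\<close>, so an exponential
  rate different from 0 at some cusp contradicts constancy.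
\<close>

lemma eta_quotient_constant_imp_zero:
  assumes X: "eta_exponents X" and const: "\<And>z. Im z > 0 \<Longrightarrow> eta_quotient X z = C"
  shows "X = (\<lambda>_. 0)"
proof (rule cusp_order_zero_imp_zero[OF X])
  fix c :: nat
  define k where "k = (\<Sum>d | X d \<noteq> 0. of_int (X d)) / (2::real)"
  have det: "1 * 1 - 0 * int c = 1" by simp
  obtain K Y where Y: "Y \<ge> 1" and KY: "\<And>z. Im z \<ge> Y \<Longrightarrow>
      eta_quotient X ((of_int 1 * z + of_int 0) / (of_int (int c) * z + of_int 1)) \<noteq> 0 \<and>
      \<bar>ln (norm (eta_quotient X ((of_int 1 * z + of_int 0) / (of_int (int c) * z + of_int 1))))
        - k * ln (norm (of_int (int c) * z + of_int 1))
        + pi / 12 * cusp_order X (nat \<bar>int c\<bar>) * Im z\<bar> \<le> K"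
    unfolding k_def by (rule eta_quotient_ln_growth_at_cusp[OF X det]) blast
  define A where "A = K + \<bar>ln (norm C)\<bar> + \<bar>k\<bar> * ln (1 + real c)"
  have bound: "\<bar>pi / 12 * cusp_order X c\<bar> \<le> (A + \<bar>k\<bar> * ln y) / y" if "y \<ge> Y" for y
  proof -
    define z where "z = Complex 0 y"
    have y: "y \<ge> 1" using that Y by simp
    define j where "j = norm (of_nat c * z + 1)"
    have j1: "1 \<le> j"
      using abs_Re_le_cmod[of "of_nat c * z + 1"] by (simp add: j_def z_def)
    have "j \<le> real c * y + 1"
      using norm_triangle_ineq[of "of_nat c * z" 1] y by (simp add: j_def z_def norm_mult complex_norm)
    also have "\<dots> \<le> (1 + real c) * y" using y by (simp add: algebra_simps)
    finally have "ln j \<le> ln ((1 + real c) * y)" using j1 by (simp add: ln_le_cancel_iff)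
    also have "\<dots> = ln (1 + real c) + ln y" using y by (simp add: ln_mult)
    finally have lnj: "0 \<le> ln j" "ln j \<le> ln (1 + real c) + ln y" using j1 by auto
    have "Im ((of_int 1 * z + of_int 0) / (of_int (int c) * z + of_int 1)) > 0"
    proof -
      have "norm (of_int (int c) * z + of_int 1) = j" by (simp add: j_def)
      thus ?thesis unfolding Im_moebius[OF det] using y j1 by (simp add: z_def)
    qed
    from const[OF this] have "\<bar>ln (norm C) - k * ln j + pi / 12 * cusp_order X c * y\<bar> \<le> K"
      using KY[of z] that by (simp add: z_def j_def)
    moreover have "\<bar>k * ln j\<bar> \<le> \<bar>k\<bar> * (ln (1 + real c) + ln y)"
      using lnj by (simp add: abs_mult mult_left_mono)
    ultimately have "\<bar>pi / 12 * cusp_order X c * y\<bar> \<le> A + \<bar>k\<bar> * ln y"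
      unfolding A_def distrib_left by linarith
    thus ?thesis
      using y by (simp add: abs_mult field_simps)
  qed
  have "((\<lambda>y. (A + \<bar>k\<bar> * ln y) / y) \<longlongrightarrow> 0) at_top"
    by real_asymp
  hence "\<bar>pi / 12 * cusp_order X c\<bar> \<le> 0"
    by (rule tendsto_lowerbound) (use bound in \<open>auto simp: eventually_at_top_linorder\<close>)
  thus "cusp_order X c = 0" by simp
qed

text \<open>
  The quotient of two equal eta quotients is the constant 1, so the difference of their exponents is
  zero. This turns the existential definitions of level, weight and factorization into statements
  about exponents.
\<close>

lemma eta_quotient_inject:
  assumes X: "eta_exponents X" and Y: "eta_exponents Y"
    and eq: "\<And>z. Im z > 0 \<Longrightarrow> eta_quotient X z = eta_quotient Y z"
  shows "X = Y"
proof -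
  define Z where "Z = (\<lambda>d. X d - Y d)"
  have Z: "eta_exponents Z" unfolding Z_def by (rule eta_exponents_diff[OF X Y])
  have "Z = (\<lambda>_. 0)"
  proof (rule eta_quotient_constant_imp_zero[OF Z])
    fix z assume z: "Im z > 0"
    have "eta_quotient (\<lambda>d. Z d + Y d) z = eta_quotient Z z * eta_quotient Y z"
      by (rule eta_quotient_add[OF Z Y z])
    moreover have "(\<lambda>d. Z d + Y d) = X" by (simp add: Z_def)
    ultimately show "eta_quotient Z z = 1"
      using eq[OF z] eta_quotient_nonzero[OF Y z] by simp
  qed
  thus ?thesis by (auto simp: Z_def fun_eq_iff)
qed

lemma holomorphic_eta_quotient_iff:
  assumes X: "eta_exponents X"
  shows "holomorphic_eta_quotient (eta_quotient X) \<longleftrightarrow> (\<forall>c. cusp_order X c \<ge> 0)"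
proof -
  define k where "k = (\<Sum>d | X d \<noteq> 0. of_int (X d)) / (2::real)"
  have weight: "has_weight (eta_quotient X) k' \<longleftrightarrow> k' = k" for k'
    using eta_quotient_inject[OF X] X unfolding has_weight_def k_def by metis
  have norm_slash: "norm (slash k a b c e (eta_quotient X) z) =
      exp (ln (norm (eta_quotient X ((of_int a * z + of_int b) / (of_int c * z + of_int e))))
        - k * ln (norm (of_int c * z + of_int e)))"
    if "a * e - b * c = 1" "Im z > 0"
      "eta_quotient X ((of_int a * z + of_int b) / (of_int c * z + of_int e)) \<noteq> 0" for a b c e z
  proof -
    have j: "of_int c * z + of_int e \<noteq> 0" using denominator_nonzero that by blast
    have "norm ((of_int c * z + of_int e) powr (- of_real k)) = exp (- k * ln (norm (of_int c * z + of_int e)))"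
      using j by (simp add: norm_powr_real_powr' powr_def)
    thus ?thesis
      using that(3) by (simp add: slash_def norm_mult exp_diff exp_minus field_simps)
  qed
  have "no_pole_at_cusps k (eta_quotient X) \<longleftrightarrow> (\<forall>c. cusp_order X c \<ge> 0)"
  proof
    assume nonneg: "\<forall>c. cusp_order X c \<ge> 0"
    show "no_pole_at_cusps k (eta_quotient X)"
      unfolding no_pole_at_cusps_def
    proof (intro allI impI)
      fix a b c e :: int assume det: "a * e - b * c = 1"
      obtain K Y where Y: "Y \<ge> 1" and KY: "\<And>z. Im z \<ge> Y \<Longrightarrow>
          eta_quotient X ((of_int a * z + of_int b) / (of_int c * z + of_int e)) \<noteq> 0 \<and>
          \<bar>ln (norm (eta_quotient X ((of_int a * z + of_int b) / (of_int c * z + of_int e))))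
            - k * ln (norm (of_int c * z + of_int e))
            + pi / 12 * cusp_order X (nat \<bar>c\<bar>) * Im z\<bar> \<le> K"
        unfolding k_def by (rule eta_quotient_ln_growth_at_cusp[OF X det]) blast
      have "norm (slash k a b c e (eta_quotient X) z) \<le> exp K" if "Im z \<ge> Y" for z
      proof -
        have "0 \<le> pi / 12 * cusp_order X (nat \<bar>c\<bar>) * Im z"
          using nonneg that Y by (intro mult_nonneg_nonneg) auto
        thus ?thesis
          using KY[OF that] that Y by (subst norm_slash[OF det]) auto
      qed
      thus "Bfun (slash k a b c e (eta_quotient X)) (filtercomap Im at_top)"
        by (intro BfunI[of _ "exp K"]) (auto simp: eventually_filtercomap_at_top_linorder)
    qed
  next
    assume no_pole: "no_pole_at_cusps k (eta_quotient X)"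
    show "\<forall>c. cusp_order X c \<ge> 0"
    proof
      fix c :: nat
      have det: "1 * 1 - 0 * int c = 1" by simp
      obtain K Y where Y: "Y \<ge> 1" and KY: "\<And>z. Im z \<ge> Y \<Longrightarrow>
          eta_quotient X ((of_int 1 * z + of_int 0) / (of_int (int c) * z + of_int 1)) \<noteq> 0 \<and>
          \<bar>ln (norm (eta_quotient X ((of_int 1 * z + of_int 0) / (of_int (int c) * z + of_int 1))))
            - k * ln (norm (of_int (int c) * z + of_int 1))
            + pi / 12 * cusp_order X (nat \<bar>int c\<bar>) * Im z\<bar> \<le> K"
        unfolding k_def by (rule eta_quotient_ln_growth_at_cusp[OF X det]) blast
      have "Bfun (slash k 1 0 (int c) 1 (eta_quotient X)) (filtercomap Im at_top)"
        using no_pole det unfolding no_pole_at_cusps_def by blast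
      then obtain B Y' where B: "B > 0" and
        BY: "\<And>z. Im z \<ge> Y' \<Longrightarrow> norm (slash k 1 0 (int c) 1 (eta_quotient X) z) \<le> B"
        by (auto simp: Bfun_def eventually_filtercomap_at_top_linorder)
      show "cusp_order X c \<ge> 0"
      proof (rule ccontr)
        assume "\<not> cusp_order X c \<ge> 0"
        define V where "V = - (pi / 12 * cusp_order X c)"
        have V: "V > 0" using \<open>\<not> _\<close> by (simp add: V_def mult_pos_neg)
        define y where "y = max (max Y Y') ((K + ln B + 1) / V)"
        define z where "z = Complex 0 y"
        have "Y \<le> y" "Y' \<le> y" "(K + ln B + 1) / V \<le> y" by (simp_all add: y_def)
        hence z: "Im z \<ge> Y" "Im z \<ge> Y'" "Im z > 0" "V * Im z \<ge> K + ln B + 1"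
          using Y V by (simp_all add: z_def pos_divide_le_eq mult.commute)
        have "exp (ln (norm (eta_quotient X ((of_int 1 * z + of_int 0) / (of_int (int c) * z + of_int 1))))
            - k * ln (norm (of_int (int c) * z + of_int 1))) \<le> B"
          using BY[OF z(2)] norm_slash[OF det z(3)] KY[OF z(1)] by simp
        also have "B = exp (ln B)" using B by simp
        finally have "ln (norm (eta_quotient X ((of_int 1 * z + of_int 0) / (of_int (int c) * z + of_int 1))))
            - k * ln (norm (of_int (int c) * z + of_int 1)) \<le> ln B"
          by (simp only: exp_le_cancel_iff)
        moreover have "pi / 12 * cusp_order X (nat \<bar>int c\<bar>) * Im z = - (V * Im z)"
          by (simp add: V_def)
        ultimately show False
          using KY[OF z(1)] z(4) by linarith
      qed
    qed
  qed
  thus ?thesis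
    unfolding holomorphic_eta_quotient_def weight by blast
qed

section \<open>Factorizations and primitivity in terms of exponents\<close>

definition divisor_exponents :: "nat \<Rightarrow> (nat \<Rightarrow> int) \<Rightarrow> bool" where
  "divisor_exponents M X \<longleftrightarrow> (\<forall>d. X d \<noteq> 0 \<longrightarrow> d dvd M)"

lemma divisor_exponents_imp_eta_exponents:
  assumes "M > 0" "divisor_exponents M X"
  shows "eta_exponents X"
proof -
  have "{d. X d \<noteq> 0} \<subseteq> {d. d dvd M}" and "X 0 = 0"
    using assms by (auto simp: divisor_exponents_def)
  moreover have "finite {d. d dvd M}"
    using assms(1) by (simp add: finite_divisors_nat)
  ultimately show ?thesis
    by (auto simp: eta_exponents_def intro: finite_subset)
qed

definition holomorphic_exponents :: "nat \<Rightarrow> (nat \<Rightarrow> int) \<Rightarrow> bool" where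
  "holomorphic_exponents M X \<longleftrightarrow> divisor_exponents M X \<and> (\<forall>c. cusp_order X c \<ge> 0)"

text \<open>
  The combinatorial counterpart of not being factorizable: the only holomorphic splittings of the
  exponent vector are the trivial ones.
\<close>

definition irreducible_exponents :: "nat \<Rightarrow> (nat \<Rightarrow> int) \<Rightarrow> bool" where
  "irreducible_exponents M X \<longleftrightarrow>
     (\<forall>Y Z. holomorphic_exponents M Y \<longrightarrow> holomorphic_exponents M Z \<longrightarrow> (\<forall>d. X d = Y d + Z d) \<longrightarrow>
        Y = (\<lambda>_. 0) \<or> Z = (\<lambda>_. 0))"

lemma eta_quotient_eq_iff:
  assumes "eta_exponents X" "eta_exponents Y"
  shows "eta_quotient X = eta_quotient Y \<longleftrightarrow> X = Y"
  using eta_quotient_inject[OF assms] by auto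

lemma has_level_eta_quotient:
  assumes "eta_exponents X"
  shows "has_level (eta_quotient X) N \<longleftrightarrow> N = Lcm {d. X d \<noteq> 0}"
  using assms eta_quotient_eq_iff[OF assms] unfolding has_level_def by metis

lemma on_Gamma0_eta_quotient:
  assumes "eta_exponents X"
  shows "on_Gamma0 M (eta_quotient X) \<longleftrightarrow> divisor_exponents M X"
  unfolding on_Gamma0_def has_level_eta_quotient[OF assms]
  by (simp add: divisor_exponents_def Lcm_dvd_iff)

lemma nonconstant_holomorphic_iff:
  assumes X: "eta_exponents X"
  shows "nonconstant_holomorphic_on_Gamma0 M (eta_quotient X) \<longleftrightarrow>
           holomorphic_exponents M X \<and> X \<noteq> (\<lambda>_. 0)"
proof -
  have "eta_quotient X constant_on upper_half_plane \<longleftrightarrow> X = (\<lambda>_. 0)"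
  proof
    assume "eta_quotient X constant_on upper_half_plane"
    then obtain C where "\<And>z. Im z > 0 \<Longrightarrow> eta_quotient X z = C"
      by (auto simp: constant_on_def upper_half_plane_def)
    thus "X = (\<lambda>_. 0)" by (rule eta_quotient_constant_imp_zero[OF X])
  next
    assume "X = (\<lambda>_. 0)"
    thus "eta_quotient X constant_on upper_half_plane"
      using eta_quotient_zero unfolding constant_on_def upper_half_plane_def by auto
  qed
  thus ?thesis
    unfolding nonconstant_holomorphic_on_Gamma0_def holomorphic_exponents_def
      on_Gamma0_eta_quotient[OF X] holomorphic_eta_quotient_iff[OF X] by blast
qed

lemma is_eta_quotient_of_holomorphic:
  "nonconstant_holomorphic_on_Gamma0 M f \<Longrightarrow> \<exists>X. eta_exponents X \<and> f = eta_quotient X"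
  unfolding nonconstant_holomorphic_on_Gamma0_def on_Gamma0_def has_level_def by blast

lemma factorizable_iff:
  assumes M: "M > 0" and X: "holomorphic_exponents M X" and "X \<noteq> (\<lambda>_. 0)"
  shows "factorizable_on_Gamma0 M (eta_quotient X) \<longleftrightarrow> \<not> irreducible_exponents M X"
proof -
  have eX: "eta_exponents X"
    using divisor_exponents_imp_eta_exponents[OF M] X by (simp add: holomorphic_exponents_def)
  show ?thesis
  proof
    assume "factorizable_on_Gamma0 M (eta_quotient X)"
    then obtain g h where gh: "nonconstant_holomorphic_on_Gamma0 M g" "nonconstant_holomorphic_on_Gamma0 M h"
      and eq: "\<And>z. Im z > 0 \<Longrightarrow> eta_quotient X z = g z * h z"
      by (auto simp: factorizable_on_Gamma0_def upper_half_plane_def)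
    obtain Y Z where Y: "eta_exponents Y" "g = eta_quotient Y" and Z: "eta_exponents Z" "h = eta_quotient Z"
      using gh is_eta_quotient_of_holomorphic by metis
    have "X = (\<lambda>d. Y d + Z d)"
      by (rule eta_quotient_inject[OF eX eta_exponents_add[OF Y(1) Z(1)]])
         (simp add: eta_quotient_add[OF Y(1) Z(1)] eq Y(2) Z(2))
    thus "\<not> irreducible_exponents M X"
      using gh unfolding Y(2) Z(2) nonconstant_holomorphic_iff[OF Y(1)] nonconstant_holomorphic_iff[OF Z(1)]
        irreducible_exponents_def by auto
  next
    assume "\<not> irreducible_exponents M X"
    then obtain Y Z where Y: "holomorphic_exponents M Y" "Y \<noteq> (\<lambda>_. 0)"
      and Z: "holomorphic_exponents M Z" "Z \<noteq> (\<lambda>_. 0)" and XYZ: "X = (\<lambda>d. Y d + Z d)"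
      unfolding irreducible_exponents_def by auto
    have eYZ: "eta_exponents Y" "eta_exponents Z"
      using divisor_exponents_imp_eta_exponents[OF M] Y Z by (simp_all add: holomorphic_exponents_def)
    have "nonconstant_holomorphic_on_Gamma0 M (eta_quotient X)"
      using X assms(3) by (simp add: nonconstant_holomorphic_iff[OF eX])
    moreover have "nonconstant_holomorphic_on_Gamma0 M (eta_quotient Y)"
      using Y by (simp add: nonconstant_holomorphic_iff[OF eYZ(1)])
    moreover have "nonconstant_holomorphic_on_Gamma0 M (eta_quotient Z)"
      using Z by (simp add: nonconstant_holomorphic_iff[OF eYZ(2)])
    moreover have "\<forall>z\<in>upper_half_plane. eta_quotient X z = eta_quotient Y z * eta_quotient Z z"
      unfolding XYZ using eta_quotient_add[OF eYZ] by (auto simp: upper_half_plane_def)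
    ultimately show "factorizable_on_Gamma0 M (eta_quotient X)"
      unfolding factorizable_on_Gamma0_def by blast
  qed
qed

lemma eta_quotient_dilate:
  fixes \<nu> :: nat
  assumes \<nu>: "\<nu> > 0" and Y: "eta_exponents Y" and z: "Im z > 0"
  shows "eta_quotient (\<lambda>d. if \<nu> dvd d then Y (d div \<nu>) else 0) z = eta_quotient Y (of_nat \<nu> * z)"
proof -
  define S where "S = {d. Y d \<noteq> 0}"
  have S: "finite S" using Y by (simp add: S_def eta_exponents_def)
  have "eta_quotient (\<lambda>d. if \<nu> dvd d then Y (d div \<nu>) else 0) z =
          (\<Prod>d\<in>(\<lambda>d. \<nu> * d) ` S. dedekind_eta (of_nat d * z) powi (if \<nu> dvd d then Y (d div \<nu>) else 0))"
    using S z by (intro eta_quotient_superset) (use \<nu> in \<open>auto simp: S_def elim!: dvdE\<close>)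
  also have "\<dots> = (\<Prod>d\<in>S. dedekind_eta (of_nat d * (of_nat \<nu> * z)) powi Y d)"
    using \<nu> by (subst prod.reindex) (auto simp: inj_on_def mult_ac)
  also have "\<dots> = eta_quotient Y (of_nat \<nu> * z)"
    using \<nu> z S by (intro eta_quotient_superset [symmetric]) (auto simp: S_def)
  finally show ?thesis .
qed

lemma eta_exponents_dilate:
  fixes \<nu> :: nat
  assumes \<nu>: "\<nu> > 0" and Y: "eta_exponents Y"
  shows "eta_exponents (\<lambda>d. if \<nu> dvd d then Y (d div \<nu>) else 0)"
proof -
  have "{d. (if \<nu> dvd d then Y (d div \<nu>) else 0) \<noteq> 0} \<subseteq> (\<lambda>d. \<nu> * d) ` {d. Y d \<noteq> 0}"
    by (auto split: if_splits elim!: dvdE)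
  from finite_subset[OF this] Y show ?thesis
    by (simp add: eta_exponents_def)
qed

text \<open>
  If the greatest common divisor of the indices is \<open>\<nu> > 1\<close>, dividing all of them by \<open>\<nu>\<close> produces a
  witness against primitivity; it is different from the given quotient because its largest index is
  smaller.
\<close>

lemma primitive_eta_quotient_iff:
  assumes X: "eta_exponents X" and nz: "X \<noteq> (\<lambda>_. 0)"
  shows "primitive_eta_quotient (eta_quotient X) \<longleftrightarrow> (\<forall>\<nu>. (\<forall>d. X d \<noteq> 0 \<longrightarrow> \<nu> dvd d) \<longrightarrow> \<nu> = 1)"
proof
  assume prim: "primitive_eta_quotient (eta_quotient X)"
  show "\<forall>\<nu>. (\<forall>d. X d \<noteq> 0 \<longrightarrow> \<nu> dvd d) \<longrightarrow> \<nu> = 1"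
  proof (intro allI impI)
    fix \<nu> assume dvd: "\<forall>d. X d \<noteq> 0 \<longrightarrow> \<nu> dvd d"
    obtain d0 where d0: "X d0 \<noteq> 0" using nz by auto
    hence "d0 > 0" "\<nu> dvd d0" using X dvd by (auto simp: eta_exponents_def intro: Nat.gr0I)
    hence \<nu>: "\<nu> > 0" by (auto intro: Nat.gr0I)
    define Y where "Y = (\<lambda>d. X (\<nu> * d))"
    have "{d. Y d \<noteq> 0} \<subseteq> (\<lambda>d. d div \<nu>) ` {d. X d \<noteq> 0}"
      using \<nu> by (auto simp: Y_def image_iff intro!: exI[of _ "\<nu> * _"])
    hence Y: "eta_exponents Y"
      using X by (auto simp: eta_exponents_def Y_def intro: finite_subset)
    have XY: "X = (\<lambda>d. if \<nu> dvd d then Y (d div \<nu>) else 0)"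
      using dvd by (auto simp: Y_def fun_eq_iff)
    have "\<forall>z\<in>upper_half_plane. eta_quotient X z = eta_quotient Y (of_nat \<nu> * z)"
      using eta_quotient_dilate[OF \<nu> Y] by (subst XY) (auto simp: upper_half_plane_def)
    hence "eta_quotient Y = eta_quotient X"
      using prim Y \<nu> unfolding primitive_eta_quotient_def is_eta_quotient_def by blast
    hence YX: "Y = X" by (simp add: eta_quotient_eq_iff[OF Y X])
    define m where "m = Max {d. X d \<noteq> 0}"
    have fin: "finite {d. X d \<noteq> 0}" using X by (simp add: eta_exponents_def)
    hence m: "X m \<noteq> 0" using d0 Max_in[of "{d. X d \<noteq> 0}"] by (auto simp: m_def)
    hence "X (\<nu> * m) \<noteq> 0" using YX by (simp add: Y_def fun_eq_iff)
    hence "\<nu> * m \<le> m" using fin by (simp add: m_def)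
    moreover have "m > 0" using m X by (auto simp: eta_exponents_def intro: Nat.gr0I)
    ultimately show "\<nu> = 1" using \<nu> by simp
  qed
next
  assume coprime: "\<forall>\<nu>. (\<forall>d. X d \<noteq> 0 \<longrightarrow> \<nu> dvd d) \<longrightarrow> \<nu> = 1"
  have "h = eta_quotient X"
    if h: "is_eta_quotient h" "\<nu> > 0" "\<forall>z\<in>upper_half_plane. eta_quotient X z = h (of_nat \<nu> * z)" for h and \<nu> :: nat
  proof -
    obtain Y where Y: "eta_exponents Y" "h = eta_quotient Y"
      using h(1) by (auto simp: is_eta_quotient_def)
    have XY: "X = (\<lambda>d. if \<nu> dvd d then Y (d div \<nu>) else 0)"
      by (rule eta_quotient_inject[OF X eta_exponents_dilate[OF h(2) Y(1)]])
         (use h Y eta_quotient_dilate[OF h(2) Y(1)] in \<open>auto simp: upper_half_plane_def\<close>)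
    hence "\<forall>d. X d \<noteq> 0 \<longrightarrow> \<nu> dvd d" by auto
    hence "\<nu> = 1" using coprime by blast
    with XY Y(2) show ?thesis by auto
  qed
  thus "primitive_eta_quotient (eta_quotient X)"
    using X unfolding primitive_eta_quotient_def is_eta_quotient_def by metis
qed

section \<open>The weight as a positive combination of orders at the cusps\<close>

lemma gcd_mult_coprime:
  fixes a b c :: nat
  assumes "coprime a b"
  shows "gcd c (a * b) = gcd c a * gcd c b"
proof (rule dvd_antisym)
  have "coprime (gcd c a) (gcd c b)"
    using assms by (meson coprime_divisors gcd_dvd2)
  thus "gcd c a * gcd c b dvd gcd c (a * b)"
    by (intro gcd_greatest divides_mult mult_dvd_mono) auto
  obtain k l where kl: "gcd c (a * b) = k * l" "k dvd a" "l dvd b"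
    using division_decomp[of "gcd c (a * b)" a b] by auto
  have "k dvd c" "l dvd c"
    using kl(1) by (metis dvd_mult_left dvd_mult_right gcd_dvd1)+
  thus "gcd c (a * b) dvd gcd c a * gcd c b"
    unfolding kl(1) using kl by (intro mult_dvd_mono) auto
qed

lemma gcd_mult_divisors:
  fixes N M :: nat
  assumes "coprime N M" "d dvd N" "e dvd M"
  shows "gcd (d * e) N = d" "gcd (d * e) M = e"
proof -
  have "coprime N e" "coprime M d"
    using assms by (meson coprime_divisors coprime_commute dvd_refl)+
  thus "gcd (d * e) N = d" "gcd (d * e) M = e"
    using gcd_mult_left_right_cancel[of N e d] gcd_mult_left_left_cancel[of M d e] assms
    by (simp_all add: gcd_nat.absorb1)
qed

lemma sum_divisors_coprime_mult:
  fixes N M :: nat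
  assumes "coprime N M"
  shows "(\<Sum>d | d dvd N * M. F d) = (\<Sum>d | d dvd N. \<Sum>e | e dvd M. F (d * e))"
proof -
  have "(\<Sum>d | d dvd N * M. F d) = (\<Sum>(d, e) \<in> {d. d dvd N} \<times> {e. e dvd M}. F (d * e))"
  proof (rule sum.reindex_bij_witness[of _ "\<lambda>(d, e). d * e" "\<lambda>d. (gcd d N, gcd d M)"])
    fix d assume "d \<in> {d. d dvd N * M}"
    hence "gcd d N * gcd d M = d"
      using gcd_mult_coprime[OF assms, of d] by (simp add: gcd_nat.absorb1)
    thus "(case (gcd d N, gcd d M) of (d, e) \<Rightarrow> d * e) = d"
      "(case (gcd d N, gcd d M) of (d, e) \<Rightarrow> F (d * e)) = F d" by simp_all
  qed (auto simp: gcd_mult_divisors[OF assms] mult_dvd_mono)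
  thus ?thesis by (simp add: sum.cartesian_product)
qed

lemma gcd_mult_mult_divisors:
  fixes N M :: nat
  assumes "coprime N M" "t dvd N" "s dvd M" "d dvd N" "e dvd M"
  shows "gcd (t * s) (d * e) = gcd t d * gcd s e"
proof -
  have cop: "coprime d e" "coprime d s" "coprime e t"
    using assms by (meson coprime_divisors coprime_commute)+
  show ?thesis
    unfolding gcd_mult_coprime[OF cop(1)]
      gcd_mult_left_right_cancel[OF cop(2)] gcd_mult_left_left_cancel[OF cop(3)] ..
qed

text \<open>
  Coefficients that write the functional \<open>Y \<mapsto> \<Sum>Y\<^sub>e\<close>, twice the weight, as a combination of the orders
  at the cusps, with a positive coefficient at every cusp. This is the valence formula; the
  coefficients are proportional to the numbers of points of the projective line over \<open>\<int>/m\<close> that lie above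
  each cusp.
\<close>

definition strictly_positive_weight :: "nat \<Rightarrow> (nat \<Rightarrow> real) \<Rightarrow> bool" where
  "strictly_positive_weight m c \<longleftrightarrow>
     (\<forall>s. s dvd m \<longrightarrow> c s > 0) \<and>
     (\<forall>e. e dvd m \<longrightarrow> (\<Sum>s | s dvd m. c s * (of_nat (gcd s e) ^ 2 / of_nat e)) = 1)"

lemma sum_divisors_prime_power:
  fixes p :: nat
  assumes "prime p"
  shows "(\<Sum>s | s dvd p ^ a. F s) = (\<Sum>i\<le>a. F (p ^ i))"
proof -
  have "{s. s dvd p ^ a} = (\<lambda>i. p ^ i) ` {..a}"
    using divides_primepow_nat[OF assms] by auto
  moreover have "inj_on (\<lambda>i. p ^ i) {..a}"
    using prime_gt_1_nat[OF assms] by (auto simp: inj_on_def)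
  ultimately show ?thesis
    by (simp add: sum.reindex)
qed

text \<open>
  The coefficient at \<open>p\<^sup>i\<close> is the proportion of points \<open>(x : c)\<close> of the projective line over \<open>\<int>/p\<^sup>a\<close>
  for which \<open>p\<^sup>i\<close> is the greatest common divisor of \<open>c\<close> and \<open>p\<^sup>a\<close>.
\<close>

lemma strictly_positive_weight_prime_power:
  fixes p :: nat
  assumes p: "prime p"
  shows "\<exists>c. strictly_positive_weight (p ^ a) c"
proof -
  define P where "P = real p"
  have P: "P > 1" using prime_gt_1_nat[OF p] by (simp add: P_def)
  \<comment> \<open>a single formula for the inner and the two outer values of \<open>i\<close>, valid for \<open>a = 0\<close> as well\<close>
  define C where "C = (\<lambda>i. ((P - 1) / P ^ i + (if i = 0 then 1 else 0) + (if i = a then 1 / P ^ a else 0)) / (P + 1))"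
  define c where "c = (\<lambda>s. C (multiplicity p s))"
  have c: "c (p ^ i) = C i" for i
    using p by (simp add: c_def)
  have geo: "(\<Sum>i\<le>n. (P - 1) * P ^ i) = P ^ Suc n - 1" for n
    by (induction n) (simp_all add: algebra_simps)
  have main: "(\<Sum>i\<le>j + k. (P - 1) / P ^ i * (P ^ (2 * min i j) / P ^ j)) = P + 1 - 1 / P ^ j - 1 / P ^ k" for j k
  proof (induction k)
    case 0
    have "(\<Sum>i\<le>j. (P - 1) / P ^ i * (P ^ (2 * min i j) / P ^ j)) = (\<Sum>i\<le>j. (P - 1) * P ^ i) / P ^ j"
      unfolding sum_divide_distrib
    proof (intro sum.cong refl)
      fix i assume "i \<in> {..j}"
      hence "P ^ (2 * min i j) = P ^ i * P ^ i" by (simp add: min_def mult_2 power_add)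
      thus "(P - 1) / P ^ i * (P ^ (2 * min i j) / P ^ j) = (P - 1) * P ^ i / P ^ j"
        using P by simp
    qed
    also have "\<dots> = P + 1 - 1 / P ^ j - 1" unfolding geo using P by (simp add: field_simps)
    finally show ?case by simp
  next
    case (Suc k)
    have "P ^ (2 * min (j + Suc k) j) = P ^ j * P ^ j"
      by (simp add: min_def mult_2 power_add)
    hence "(P - 1) / P ^ (j + Suc k) * (P ^ (2 * min (j + Suc k) j) / P ^ j) = (P - 1) / P ^ Suc k"
      using P by (simp add: power_add)
    also have "\<dots> = 1 / P ^ k - 1 / P ^ Suc k"
      using P by (simp add: field_simps)
    finally show ?case
      using Suc.IH by (simp add: algebra_simps)
  qed
  have "strictly_positive_weight (p ^ a) c"
    unfolding strictly_positive_weight_def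
  proof (intro conjI allI impI)
    fix s assume "s dvd p ^ a"
    then obtain i where i: "s = p ^ i" using divides_primepow_nat[OF p] by auto
    show "c s > 0" unfolding i c C_def using P
      by (intro divide_pos_pos add_pos_nonneg) auto
  next
    fix e assume "e dvd p ^ a"
    then obtain j where j: "j \<le> a" "e = p ^ j" using divides_primepow_nat[OF p] by auto
    have gcd: "gcd (p ^ i) (p ^ j) = p ^ min i j" for i
      by (cases "i \<le> j") (auto simp: min_def le_imp_power_dvd gcd_nat.absorb1 gcd_nat.absorb2)
    have "(\<Sum>s | s dvd p ^ a. c s * (of_nat (gcd s e) ^ 2 / of_nat e)) =
          (\<Sum>i\<le>a. C i * (P ^ (2 * min i j) / P ^ j))"
      unfolding sum_divisors_prime_power[OF p] c j(2) gcd
      by (simp add: P_def power_mult [symmetric] mult.commute)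
    also have "\<dots> = ((\<Sum>i\<le>a. (P - 1) / P ^ i * (P ^ (2 * min i j) / P ^ j)) +
        (\<Sum>i\<le>a. if i = 0 then P ^ (2 * min i j) / P ^ j else 0) +
        (\<Sum>i\<le>a. if i = a then 1 / P ^ a * (P ^ (2 * min i j) / P ^ j) else 0)) / (P + 1)"
    proof -
      have "C i * w = ((P - 1) / P ^ i * w + (if i = 0 then w else 0) + (if i = a then 1 / P ^ a * w else 0)) / (P + 1)" for i w
        unfolding C_def by (cases "i = 0"; cases "i = a") (simp_all only: if_True if_False simp_thms distrib_right times_divide_eq_left mult_1 mult_zero_left mult_zero_right add_0_right)
      thus ?thesis
        by (simp only: sum.distrib [symmetric] sum_divide_distrib)
    qed
    also have "\<dots> = ((P + 1 - 1 / P ^ j - 1 / P ^ (a - j)) + 1 / P ^ j + P ^ j / P ^ a) / (P + 1)"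
      using main[of j "a - j"] j(1) P by (simp add: min_def mult_2 power_add)
    also have "P ^ j / P ^ a = 1 / P ^ (a - j)"
      using P j(1) by (simp add: power_diff field_simps)
    finally show "(\<Sum>s | s dvd p ^ a. c s * (of_nat (gcd s e) ^ 2 / of_nat e)) = 1"
      using P by simp
  qed
  thus ?thesis by blast
qed

lemma strictly_positive_weight_mult:
  assumes cop: "coprime m n" and c1: "strictly_positive_weight m c1" and c2: "strictly_positive_weight n c2"
  shows "strictly_positive_weight (m * n) (\<lambda>s. c1 (gcd s m) * c2 (gcd s n))"
  unfolding strictly_positive_weight_def
proof (intro conjI allI impI)
  fix s assume "s dvd m * n"
  thus "c1 (gcd s m) * c2 (gcd s n) > 0"
    using c1 c2 by (simp add: strictly_positive_weight_def)
next
  fix e assume "e dvd m * n"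
  then obtain e1 e2 where e: "e = e1 * e2" "e1 dvd m" "e2 dvd n"
    using division_decomp by blast
  have "(\<Sum>s | s dvd m * n. c1 (gcd s m) * c2 (gcd s n) * (of_nat (gcd s e) ^ 2 / of_nat e)) =
      (\<Sum>s | s dvd m. \<Sum>t | t dvd n. (c1 s * (of_nat (gcd s e1) ^ 2 / of_nat e1)) * (c2 t * (of_nat (gcd t e2) ^ 2 / of_nat e2)))"
    unfolding sum_divisors_coprime_mult[OF cop] e(1)
    by (intro sum.cong refl)
       (simp add: gcd_mult_divisors[OF cop] gcd_mult_mult_divisors[OF cop] e power_mult_distrib mult_ac)
  also have "\<dots> = (\<Sum>s | s dvd m. c1 s * (of_nat (gcd s e1) ^ 2 / of_nat e1)) *
                 (\<Sum>t | t dvd n. c2 t * (of_nat (gcd t e2) ^ 2 / of_nat e2))"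
    by (simp add: sum_product)
  also have "\<dots> = 1"
    using c1 c2 e by (simp add: strictly_positive_weight_def)
  finally show "(\<Sum>s | s dvd m * n. c1 (gcd s m) * c2 (gcd s n) * (of_nat (gcd s e) ^ 2 / of_nat e)) = 1" .
qed

lemma strictly_positive_weight_exists:
  assumes "m > 0"
  shows "\<exists>c. strictly_positive_weight m c"
  using assms
proof (induction m rule: less_induct)
  case (less m)
  show ?case
  proof (cases "m = 1")
    case True
    thus ?thesis by (intro exI[of _ "\<lambda>_. 1"]) (simp add: strictly_positive_weight_def)
  next
    case False
    then obtain p where p: "prime p" "p dvd m" using prime_factor_nat by blast
    obtain m' where m': "m = p ^ multiplicity p m * m'" "\<not> p dvd m'"
      by (rule multiplicity_decompose'[of m p]) (use prime_gt_1_nat[OF p(1)] less.prems in auto)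
    have "multiplicity p m > 0" using p less.prems by (simp add: prime_multiplicity_gt_zero_iff)
    hence "p ^ multiplicity p m > 1" using prime_gt_1_nat[OF p(1)] by (intro one_less_power)
    moreover have "m' > 0" using m' by (intro Nat.gr0I) auto
    ultimately have "m' < m" by (subst m'(1)) simp
    then obtain c1 c2 where "strictly_positive_weight (p ^ multiplicity p m) c1" "strictly_positive_weight m' c2"
      using less.IH[of m'] strictly_positive_weight_prime_power[OF p(1)] \<open>m' > 0\<close> by blast
    moreover have "coprime (p ^ multiplicity p m) m'"
      using p(1) m'(2) by (simp add: prime_imp_coprime)
    ultimately show ?thesis
      using strictly_positive_weight_mult m'(1) by metis
  qed
qed

lemma cusp_order_divisors:
  assumes "N > 0" "divisor_exponents N X"
  shows "cusp_order X c = (\<Sum>d | d dvd N. of_nat (gcd c d) ^ 2 / of_nat d * of_int (X d))"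
  using assms by (intro cusp_order_superset) (auto simp: divisor_exponents_def finite_divisors_nat)

text \<open>
  Reduces statements about all cusps to the cusps \<open>a / t\<close> with \<open>t dvd N\<close>.
\<close>

lemma cusp_order_gcd:
  assumes "N > 0" "divisor_exponents N X"
  shows "cusp_order X (gcd c N) = cusp_order X c"
  unfolding cusp_order_divisors[OF assms]
  by (intro sum.cong refl) (simp add: gcd.assoc gcd_nat.absorb2)

text \<open>
  Twice the weight, taken only in the variable \<open>e dvd M\<close> of \<open>d * e dvd N * M\<close>. It maps exponents of
  level \<open>N * M\<close> to integral exponents of level \<open>N\<close>.
\<close>

definition partial_weight :: "nat \<Rightarrow> nat \<Rightarrow> (nat \<Rightarrow> int) \<Rightarrow> nat \<Rightarrow> int" where
  "partial_weight N M Z = (\<lambda>d. if d dvd N then \<Sum>e | e dvd M. Z (d * e) else 0)"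

lemma divisor_exponents_partial_weight: "divisor_exponents N (partial_weight N M Z)"
  by (simp add: divisor_exponents_def partial_weight_def)

text \<open>
  The matrix of orders for \<open>N * M\<close> is the Kronecker product of those for \<open>N\<close> and \<open>M\<close>, so writing the
  weight on the factor \<open>M\<close> through the orders at its cusps does the same for the partial weight.
\<close>

lemma cusp_order_partial_weight:
  assumes pos: "N > 0" "M > 0" and cop: "coprime N M" and Z: "divisor_exponents (N * M) Z"
    and c: "strictly_positive_weight M c" and t: "t dvd N"
  shows "cusp_order (partial_weight N M Z) t = (\<Sum>s | s dvd M. c s * cusp_order Z (t * s))"
proof -
  have NM: "N * M > 0" using pos by simp
  have "(\<Sum>s | s dvd M. c s * cusp_order Z (t * s)) =
      (\<Sum>s | s dvd M. \<Sum>d | d dvd N. \<Sum>e | e dvd M.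
         (c s * (of_nat (gcd s e) ^ 2 / of_nat e)) * (of_nat (gcd t d) ^ 2 / of_nat d * of_int (Z (d * e))))"
    unfolding cusp_order_divisors[OF NM Z] sum_divisors_coprime_mult[OF cop] sum_distrib_left
    by (intro sum.cong refl, subst gcd_mult_mult_divisors[OF cop t]) (auto simp: power_mult_distrib mult_ac)
  also have "\<dots> = (\<Sum>d | d dvd N. \<Sum>s | s dvd M. \<Sum>e | e dvd M.
         (c s * (of_nat (gcd s e) ^ 2 / of_nat e)) * (of_nat (gcd t d) ^ 2 / of_nat d * of_int (Z (d * e))))"
    by (rule sum.swap)
  also have "\<dots> = (\<Sum>d | d dvd N. \<Sum>e | e dvd M. \<Sum>s | s dvd M.
         (c s * (of_nat (gcd s e) ^ 2 / of_nat e)) * (of_nat (gcd t d) ^ 2 / of_nat d * of_int (Z (d * e))))"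
    by (intro sum.cong refl sum.swap)
  also have "\<dots> = (\<Sum>d | d dvd N. \<Sum>e | e dvd M. of_nat (gcd t d) ^ 2 / of_nat d * of_int (Z (d * e)))"
    using c by (intro sum.cong refl, subst sum_distrib_right [symmetric]) (simp add: strictly_positive_weight_def)
  also have "\<dots> = cusp_order (partial_weight N M Z) t"
    unfolding cusp_order_divisors[OF pos(1) divisor_exponents_partial_weight]
    by (intro sum.cong refl) (simp add: partial_weight_def sum_distrib_left)
  finally show ?thesis ..
qed

lemma holomorphic_partial_weight:
  assumes pos: "N > 0" "M > 0" and cop: "coprime N M" and Z: "holomorphic_exponents (N * M) Z"
  shows "holomorphic_exponents N (partial_weight N M Z)"
proof -
  obtain c where c: "strictly_positive_weight M c"
    using strictly_positive_weight_exists[OF pos(2)] by blast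
  have Z': "divisor_exponents (N * M) Z" "\<And>c. cusp_order Z c \<ge> 0"
    using Z by (auto simp: holomorphic_exponents_def)
  have "cusp_order (partial_weight N M Z) t \<ge> 0" if "t dvd N" for t
    unfolding cusp_order_partial_weight[OF pos cop Z'(1) c that]
    using c Z'(2) by (intro sum_nonneg mult_nonneg_nonneg) (auto simp: strictly_positive_weight_def less_imp_le)
  from this[of "gcd _ N"] show ?thesis
    unfolding holomorphic_exponents_def
    by (simp add: divisor_exponents_partial_weight cusp_order_gcd[OF pos(1) divisor_exponents_partial_weight])
qed

text \<open>
  Strict positivity of the coefficients forces every order at a cusp to vanish.
\<close>

lemma partial_weight_zero_imp_zero:
  assumes pos: "N > 0" "M > 0" and cop: "coprime N M" and Z: "holomorphic_exponents (N * M) Z"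
    and zero: "partial_weight N M Z = (\<lambda>_. 0)"
  shows "Z = (\<lambda>_. 0)"
proof (rule cusp_order_zero_imp_zero)
  have NM: "N * M > 0" using pos by simp
  have Z': "divisor_exponents (N * M) Z" "\<And>c. cusp_order Z c \<ge> 0"
    using Z by (auto simp: holomorphic_exponents_def)
  show "eta_exponents Z"
    by (rule divisor_exponents_imp_eta_exponents[OF NM Z'(1)])
  obtain c where c: "strictly_positive_weight M c"
    using strictly_positive_weight_exists[OF pos(2)] by blast
  have *: "cusp_order Z (t * s) = 0" if "t dvd N" "s dvd M" for t s
  proof -
    have fin: "finite {s. s dvd M}" using pos by (simp add: finite_divisors_nat)
    have "(\<Sum>s | s dvd M. c s * cusp_order Z (t * s)) = 0"
      using cusp_order_partial_weight[OF pos cop Z'(1) c that(1)] by (simp add: zero cusp_order_def)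
    moreover have "\<forall>s\<in>{s. s dvd M}. c s * cusp_order Z (t * s) \<ge> 0"
      using c Z'(2) by (auto simp: strictly_positive_weight_def less_imp_le)
    ultimately have "c s * cusp_order Z (t * s) = 0"
      using that(2) fin by (subst (asm) sum_nonneg_eq_0_iff) auto
    thus ?thesis using c that(2) by (auto simp: strictly_positive_weight_def)
  qed
  fix k
  have "cusp_order Z k = cusp_order Z (gcd k N * gcd k M)"
    using cusp_order_gcd[OF NM Z'(1), of k] by (simp add: gcd_mult_coprime[OF cop])
  thus "cusp_order Z k = 0" using * by simp
qed

section \<open>Products of coprime level\<close>

text \<open>
  Dirichlet convolution. For exponents supported on the divisors of coprime numbers this is the
  tensor product, where \<open>X\<^sub>d Y\<^sub>e\<close> is the exponent of \<open>\<eta>\<^bsub>de\<^esub>\<close>, in a form that is free of the levels.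
\<close>

definition exponent_product :: "(nat \<Rightarrow> int) \<Rightarrow> (nat \<Rightarrow> int) \<Rightarrow> nat \<Rightarrow> int" where
  "exponent_product X Y n = (\<Sum>d | d dvd n. X d * Y (n div d))"

lemma exponent_product_mult:
  assumes pos: "N > 0" "M > 0" and cop: "coprime N M"
    and X: "divisor_exponents N X" and Y: "divisor_exponents M Y" and de: "d dvd N" "e dvd M"
  shows "exponent_product X Y (d * e) = X d * Y e"
proof -
  have d0: "d > 0" "e > 0" using pos de by (auto intro: dvd_pos_nat)
  have "X k * Y (d * e div k) = 0" if k: "k dvd d * e" "k \<noteq> d" for k
  proof (rule ccontr)
    assume "X k * Y (d * e div k) \<noteq> 0"
    hence "k dvd N" "d * e div k dvd M"
      using X Y by (auto simp: divisor_exponents_def)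
    hence "gcd (k * (d * e div k)) N = k"
      by (rule gcd_mult_divisors[OF cop])
    moreover have "k * (d * e div k) = d * e" using k by simp
    ultimately show False
      using gcd_mult_divisors[OF cop de] k by simp
  qed
  hence "exponent_product X Y (d * e) = (\<Sum>k\<in>{d}. X k * Y (d * e div k))"
    unfolding exponent_product_def using d0
    by (intro sum.mono_neutral_right) (auto simp: finite_divisors_nat)
  thus ?thesis using d0 by simp
qed

lemma divisor_exponents_product:
  assumes X: "divisor_exponents N X" and Y: "divisor_exponents M Y"
  shows "divisor_exponents (N * M) (exponent_product X Y)"
  unfolding divisor_exponents_def
proof (intro allI impI)
  fix n assume "exponent_product X Y n \<noteq> 0"
  then obtain d where "d \<in> {d. d dvd n}" "X d * Y (n div d) \<noteq> 0"
    unfolding exponent_product_def by (rule sum.not_neutral_contains_not_neutral)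
  hence d: "d dvd n" "X d \<noteq> 0" "Y (n div d) \<noteq> 0" by auto
  hence "d * (n div d) dvd N * M"
    using X Y by (intro mult_dvd_mono) (auto simp: divisor_exponents_def)
  thus "n dvd N * M" using d(1) by simp
qed

lemma cusp_order_product:
  assumes pos: "N > 0" "M > 0" and cop: "coprime N M"
    and X: "divisor_exponents N X" and Y: "divisor_exponents M Y"
  shows "cusp_order (exponent_product X Y) c = cusp_order X c * cusp_order Y c"
proof -
  have NM: "N * M > 0" using pos by simp
  have "cusp_order (exponent_product X Y) c =
      (\<Sum>d | d dvd N. \<Sum>e | e dvd M. (of_nat (gcd c d) ^ 2 / of_nat d * of_int (X d)) * (of_nat (gcd c e) ^ 2 / of_nat e * of_int (Y e)))"
    unfolding cusp_order_divisors[OF NM divisor_exponents_product[OF X Y]] sum_divisors_coprime_mult[OF cop]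
  proof (intro sum.cong refl)
    fix d e assume "d \<in> {d. d dvd N}" "e \<in> {e. e dvd M}"
    hence de: "d dvd N" "e dvd M" by auto
    have "coprime d e" by (rule coprime_divisors[OF de cop])
    show "of_nat (gcd c (d * e)) ^ 2 / of_nat (d * e) * real_of_int (exponent_product X Y (d * e)) =
        (of_nat (gcd c d) ^ 2 / of_nat d * of_int (X d)) * (of_nat (gcd c e) ^ 2 / of_nat e * of_int (Y e))"
      unfolding exponent_product_mult[OF pos cop X Y de] gcd_mult_coprime[OF \<open>coprime d e\<close>]
      by (simp only: of_nat_mult of_int_mult power_mult_distrib times_divide_times_eq mult_ac)
  qed
  also have "\<dots> = cusp_order X c * cusp_order Y c"
    unfolding cusp_order_divisors[OF pos(1) X] cusp_order_divisors[OF pos(2) Y] by (simp only: sum_product)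
  finally show ?thesis .
qed

text \<open>
  The heart of the matter. If the product with an exponent vector of weight \<open>1/2\<close> splits as
  \<open>Z\<^sub>1 + Z\<^sub>2\<close>, then the partial weights split \<open>X\<close>, as twice the weight of \<open>Y\<close> contributes the factor 1.
  Irreducibility of \<open>X\<close> makes one of the two partial weights vanish, and then \<open>Z\<^sub>1\<close> or \<open>Z\<^sub>2\<close> vanishes
  itself.
\<close>

lemma irreducible_exponents_product:
  assumes pos: "N > 0" "M > 0" and cop: "coprime N M"
    and X: "divisor_exponents N X" and irr: "irreducible_exponents N X"
    and Y: "divisor_exponents M Y" and weight: "(\<Sum>e | e dvd M. Y e) = 1"
  shows "irreducible_exponents (N * M) (exponent_product X Y)"
  unfolding irreducible_exponents_def
proof (intro allI impI)
  fix Z1 Z2 assume Z: "holomorphic_exponents (N * M) Z1" "holomorphic_exponents (N * M) Z2"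
    and sum: "\<forall>d. exponent_product X Y d = Z1 d + Z2 d"
  have "X d = partial_weight N M Z1 d + partial_weight N M Z2 d" for d
  proof (cases "d dvd N")
    case True
    have "(\<Sum>e | e dvd M. exponent_product X Y (d * e)) = X d * (\<Sum>e | e dvd M. Y e)"
      unfolding sum_distrib_left
      by (intro sum.cong refl) (simp add: exponent_product_mult[OF pos cop X Y True])
    thus ?thesis
      using True sum weight by (simp add: partial_weight_def sum.distrib)
  qed (use X in \<open>auto simp: partial_weight_def divisor_exponents_def\<close>)
  hence "partial_weight N M Z1 = (\<lambda>_. 0) \<or> partial_weight N M Z2 = (\<lambda>_. 0)"
    using irr holomorphic_partial_weight[OF pos cop Z(1)] holomorphic_partial_weight[OF pos cop Z(2)]
    unfolding irreducible_exponents_def by blast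
  thus "Z1 = (\<lambda>_. 0) \<or> Z2 = (\<lambda>_. 0)"
    using partial_weight_zero_imp_zero[OF pos cop] Z by blast
qed

lemma exponent_product_eta_1: "exponent_product ((\<lambda>_. 0)(1 := 1)) Y n = (if n = 0 then 0 else Y n)"
proof (cases "n = 0")
  case False
  have "exponent_product ((\<lambda>_. 0)(1 := 1)) Y n = (\<Sum>d\<in>{1}. ((\<lambda>_. 0)(1 := 1)) d * Y (n div d))"
    unfolding exponent_product_def using False
    by (intro sum.mono_neutral_right) (auto simp: finite_divisors_nat)
  thus ?thesis using False by simp
qed (simp add: exponent_product_def)

lemma holomorphic_exponents_eta: "holomorphic_exponents N ((\<lambda>_. 0)(1 := 1))"
proof -
  have "cusp_order ((\<lambda>_. 0)(1 := 1)) c \<ge> 0" for c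
    by (subst cusp_order_superset[of "{1}"]) (auto split: if_splits)
  thus ?thesis by (auto simp: holomorphic_exponents_def divisor_exponents_def)
qed

text \<open>
  The case of trivial level and \<open>X = \<eta>\<close> of \<open>irreducible_exponents_product\<close>, since \<open>\<eta>\<close> has weight \<open>1/2\<close> and
  a vector of trivial level is just an integer.
\<close>

lemma irreducible_exponents_eta:
  assumes "N > 0"
  shows "irreducible_exponents N ((\<lambda>_. 0)(1 := 1))"
proof -
  let ?E = "(\<lambda>_. 0)(1 := 1) :: nat \<Rightarrow> int"
  have "irreducible_exponents 1 ?E"
    unfolding irreducible_exponents_def
  proof (intro allI impI)
    fix Y Z assume YZ: "holomorphic_exponents 1 Y" "holomorphic_exponents 1 Z" "\<forall>d. ?E d = Y d + Z d"
    have *: "W 1 \<ge> 0" "W 1 = 0 \<longrightarrow> W = (\<lambda>_. 0)" if W: "holomorphic_exponents 1 W" for W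
    proof -
      have d: "divisor_exponents 1 W" using W by (simp add: holomorphic_exponents_def)
      have "cusp_order W 1 = of_int (W 1)"
        by (subst cusp_order_divisors[OF _ d]) simp_all
      thus "W 1 \<ge> 0" using W by (metis holomorphic_exponents_def of_int_0_le_iff)
      show "W 1 = 0 \<longrightarrow> W = (\<lambda>_. 0)"
        using d by (auto simp: divisor_exponents_def fun_eq_iff)
    qed
    have "Y 1 + Z 1 = 1" using YZ(3) by (metis fun_upd_same)
    hence "Y 1 = 0 \<or> Z 1 = 0" using *(1)[OF YZ(1)] *(1)[OF YZ(2)] by linarith
    thus "Y = (\<lambda>_. 0) \<or> Z = (\<lambda>_. 0)" using *(2) YZ by blast
  qed
  moreover have "(\<Sum>e | e dvd N. ?E e) = 1"
    using assms by (simp add: finite_divisors_nat)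
  ultimately have "irreducible_exponents (1 * N) (exponent_product ?E ?E)"
    using assms by (intro irreducible_exponents_product) (auto simp: divisor_exponents_def)
  moreover have "exponent_product ?E ?E = ?E"
    by (rule ext) (subst exponent_product_eta_1, simp)
  ultimately show ?thesis by simp
qed

text \<open>
  Used to reduce a multiple of the product of two coprime levels to coprime multiples of the two
  levels: the second factor collects the primes that divide \<open>M\<close>.
\<close>

lemma coprime_multiple_decomposition:
  fixes K :: nat
  assumes K: "K > 0" and cop: "coprime N M" and dvd: "N * M dvd K"
  obtains N' M' where "K = N' * M'" "coprime N' M'" "N dvd N'" "M dvd M'"
proof -
  have "\<exists>N' M'. K = N' * M' \<and> coprime N' M \<and> (\<forall>p. prime p \<longrightarrow> p dvd M' \<longrightarrow> p dvd M)"
    using K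
  proof (induction K rule: less_induct)
    case (less K)
    show ?case
    proof (cases "coprime K M")
      case True
      thus ?thesis by (intro exI[of _ K] exI[of _ 1]) auto
    next
      case False
      then obtain p where p: "prime p" "p dvd K" "p dvd M"
        using prime_factor_nat[of "gcd K M"] by (auto simp: coprime_iff_gcd_eq_1)
      then obtain K2 where K2: "K = p * K2" by auto
      hence "K2 < K" "K2 > 0" using less.prems prime_gt_1_nat[OF p(1)] by auto
      then obtain N' M' where "K2 = N' * M'" "coprime N' M" "\<forall>p. prime p \<longrightarrow> p dvd M' \<longrightarrow> p dvd M"
        using less.IH by blast
      note IH = this
      have "q dvd M" if "prime q" "q dvd p * M'" for q
      proof -
        have "q dvd p \<or> q dvd M'" using that prime_dvd_mult_iff by blast
        thus ?thesis using IH(3) that(1) p(1,3) primes_dvd_imp_eq by blast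
      qed
      moreover have "K = N' * (p * M')" using K2 IH(1) by simp
      ultimately show ?thesis using IH(2) by blast
    qed
  qed
  then obtain N' M' where NM: "K = N' * M'" "coprime N' M" "\<And>p. prime p \<Longrightarrow> p dvd M' \<Longrightarrow> p dvd M"
    by blast
  have M'_cop: "coprime M' L" if "coprime M L" for L
  proof (rule ccontr)
    assume "\<not> coprime M' L"
    then obtain p where p: "prime p" "p dvd M'" "p dvd L"
      using prime_factor_nat[of "gcd M' L"] by (auto simp: coprime_iff_gcd_eq_1)
    have "p dvd gcd M L" using NM(3)[OF p(1,2)] p(3) by simp
    moreover have "gcd M L = 1" using that by simp
    ultimately show False using p(1) not_prime_unit by metis
  qed
  show ?thesis
  proof (rule that[OF NM(1)])
    show "coprime N' M'" using M'_cop[of N'] NM(2) by (simp add: coprime_commute)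
    have "coprime N M'" using M'_cop[of N] cop by (simp add: coprime_commute)
    moreover have "N dvd N' * M'" using dvd_mult_left[OF dvd] NM(1) by simp
    ultimately show "N dvd N'" by (simp only: coprime_dvd_mult_left_iff)
    have "coprime M N'" using NM(2) by (simp add: coprime_commute)
    moreover have "M dvd N' * M'" using dvd_mult_right[OF dvd] NM(1) by simp
    ultimately show "M dvd M'" by (simp only: coprime_dvd_mult_right_iff)
  qed
qed

section \<open>Products with eta quotients of weight one half\<close>

text \<open>
  The exponents of holomorphic eta quotients of weight \<open>1/2\<close> that serve as second factors. The
  condition at \<open>M\<close> makes the level exactly \<open>M\<close>, and the one at 1 carries primitivity of the first
  factor over to the product.
\<close>

definition half_weight_shape :: "nat \<Rightarrow> (nat \<Rightarrow> int) \<Rightarrow> bool" where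
  "half_weight_shape M Y \<longleftrightarrow>
     holomorphic_exponents M Y \<and> (\<Sum>e | e dvd M. Y e) = 1 \<and> Y 1 \<noteq> 0 \<and> Y M \<noteq> 0"

lemma divisor_exponents_dvd:
  "divisor_exponents M Y \<Longrightarrow> M dvd M' \<Longrightarrow> divisor_exponents M' Y"
  by (auto simp: divisor_exponents_def intro: dvd_trans)

lemma half_weight_shape_sum:
  assumes Y: "half_weight_shape M Y" and "M dvd M'" "M' > 0"
  shows "(\<Sum>e | e dvd M'. Y e) = 1"
proof -
  have "(\<Sum>e | e dvd M'. Y e) = (\<Sum>e | e dvd M. Y e)"
    using assms by (intro sum.mono_neutral_right)
      (auto simp: finite_divisors_nat half_weight_shape_def holomorphic_exponents_def divisor_exponents_def intro: dvd_trans)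
  thus ?thesis using Y by (simp add: half_weight_shape_def)
qed

lemma level_pos: "has_level f N \<Longrightarrow> N > 0"
  unfolding has_level_def eta_exponents_def by (auto simp: Lcm_0_iff intro!: Nat.gr0I)

lemma Lcm_support_product:
  assumes pos: "N > 0" "M > 0" and cop: "coprime N M"
    and lev: "Lcm {d. X d \<noteq> 0} = N" and nz: "X \<noteq> (\<lambda>_. 0)" and Y: "half_weight_shape M Y"
  shows "Lcm {n. exponent_product X Y n \<noteq> 0} = M * N"
proof (rule dvd_antisym)
  have X: "divisor_exponents N X" using lev by (auto simp: divisor_exponents_def)
  have Y': "divisor_exponents M Y" "Y M \<noteq> 0" using Y by (auto simp: half_weight_shape_def holomorphic_exponents_def)
  show "Lcm {n. exponent_product X Y n \<noteq> 0} dvd M * N"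
    using divisor_exponents_product[OF X Y'(1)] by (intro Lcm_least) (auto simp: divisor_exponents_def mult.commute)
  have *: "d * M dvd Lcm {n. exponent_product X Y n \<noteq> 0}" if "X d \<noteq> 0" for d
  proof (rule dvd_Lcm)
    have "d dvd N" using that X by (simp add: divisor_exponents_def)
    thus "d * M \<in> {n. exponent_product X Y n \<noteq> 0}"
      using exponent_product_mult[OF pos cop X Y'(1), of d M] that Y' by simp
  qed
  have "Lcm {d. X d \<noteq> 0} dvd Lcm {n. exponent_product X Y n \<noteq> 0}"
    using * by (intro Lcm_least) (auto dest: dvd_mult_left)
  moreover obtain d where "X d \<noteq> 0" using nz by auto
  hence "M dvd Lcm {n. exponent_product X Y n \<noteq> 0}" using *[of d] by (auto dest: dvd_mult_right)
  ultimately show "M * N dvd Lcm {n. exponent_product X Y n \<noteq> 0}"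
    using cop unfolding lev by (intro divides_mult) (auto simp: coprime_commute)
qed

lemma factorizable_on_multiple_iff:
  assumes M: "M > 0" and X: "eta_exponents X" and nz: "X \<noteq> (\<lambda>_. 0)"
    and lev: "Lcm {d. X d \<noteq> 0} = N" and hol: "\<forall>c. cusp_order X c \<ge> 0" and dvd: "N dvd M"
  shows "factorizable_on_Gamma0 M (eta_quotient X) \<longleftrightarrow> \<not> irreducible_exponents M X"
proof -
  have "divisor_exponents M X"
    using lev dvd by (auto simp: divisor_exponents_def intro: dvd_trans)
  thus ?thesis
    using factorizable_iff[OF M _ nz] hol by (simp add: holomorphic_exponents_def)
qed

lemma quasi_irreducible_iff:
  assumes N: "N > 0" and X: "eta_exponents X" and nz: "X \<noteq> (\<lambda>_. 0)"
  shows "quasi_irreducible N (eta_quotient X) \<longleftrightarrow>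
           Lcm {d. X d \<noteq> 0} = N \<and> (\<forall>c. cusp_order X c \<ge> 0) \<and> irreducible_exponents N X"
  unfolding quasi_irreducible_def holomorphic_eta_quotient_iff[OF X] has_level_eta_quotient[OF X]
  using factorizable_on_multiple_iff[OF N X nz] by auto

lemma irreducible_eta_quotient_iff:
  assumes X: "eta_exponents X" and nz: "X \<noteq> (\<lambda>_. 0)"
  shows "irreducible_eta_quotient N (eta_quotient X) \<longleftrightarrow>
           Lcm {d. X d \<noteq> 0} = N \<and> (\<forall>c. cusp_order X c \<ge> 0) \<and>
           (\<forall>M>0. N dvd M \<longrightarrow> irreducible_exponents M X)"
  unfolding irreducible_eta_quotient_def holomorphic_eta_quotient_iff[OF X] has_level_eta_quotient[OF X]
  using factorizable_on_multiple_iff[OF _ X nz] by auto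

lemma exponent_product_nonzero:
  assumes pos: "N > 0" "M > 0" and cop: "coprime N M"
    and X: "divisor_exponents N X" "X \<noteq> (\<lambda>_. 0)" and Y: "half_weight_shape M Y"
  shows "exponent_product X Y \<noteq> (\<lambda>_. 0)"
proof -
  obtain d where d: "X d \<noteq> 0" using X(2) by auto
  hence "d dvd N" using X(1) by (simp add: divisor_exponents_def)
  hence "exponent_product X Y (d * 1) \<noteq> 0"
    using exponent_product_mult[OF pos cop X(1), of Y d 1] d Y
    by (simp add: half_weight_shape_def holomorphic_exponents_def)
  thus ?thesis by auto
qed

lemma quasi_irreducible_product:
  assumes pos: "N > 0" "M > 0" and cop: "coprime N M" and X: "eta_exponents X" "X \<noteq> (\<lambda>_. 0)"
    and irr: "quasi_irreducible N (eta_quotient X)" and Y: "half_weight_shape M Y"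
  shows "quasi_irreducible (M * N) (eta_quotient (exponent_product X Y))"
proof -
  have X': "Lcm {d. X d \<noteq> 0} = N" "\<forall>c. cusp_order X c \<ge> 0" "irreducible_exponents N X"
    using irr by (auto simp: quasi_irreducible_iff[OF pos(1) X])
  have dX: "divisor_exponents N X" using X'(1) by (auto simp: divisor_exponents_def)
  have Y': "divisor_exponents M Y" "\<forall>c. cusp_order Y c \<ge> 0" "(\<Sum>e | e dvd M. Y e) = 1"
    using Y by (auto simp: half_weight_shape_def holomorphic_exponents_def)
  have MN: "M * N > 0" "N * M > 0" using pos by simp_all
  have "eta_exponents (exponent_product X Y)"
    by (rule divisor_exponents_imp_eta_exponents[OF MN(2) divisor_exponents_product[OF dX Y'(1)]])
  moreover have "irreducible_exponents (M * N) (exponent_product X Y)"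
    using irreducible_exponents_product[OF pos cop dX X'(3) Y'(1,3)] by (simp add: mult.commute)
  ultimately show ?thesis
    using X' Y' Lcm_support_product[OF pos cop X'(1) X(2) Y] exponent_product_nonzero[OF pos cop dX X(2) Y]
    by (simp add: quasi_irreducible_iff[OF MN(1)] cusp_order_product[OF pos cop dX Y'(1)])
qed

lemma primitive_product:
  assumes pos: "N > 0" "M > 0" and cop: "coprime N M"
    and X: "divisor_exponents N X" "X \<noteq> (\<lambda>_. 0)" and prim: "primitive_eta_quotient (eta_quotient X)"
    and Y: "half_weight_shape M Y"
  shows "primitive_eta_quotient (eta_quotient (exponent_product X Y))"
proof -
  have Y': "divisor_exponents M Y" "Y 1 \<noteq> 0"
    using Y by (auto simp: half_weight_shape_def holomorphic_exponents_def)
  have NM: "N * M > 0" using pos by simp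
  have eX: "eta_exponents X" by (rule divisor_exponents_imp_eta_exponents[OF pos(1) X(1)])
  have eXY: "eta_exponents (exponent_product X Y)"
    by (rule divisor_exponents_imp_eta_exponents[OF NM divisor_exponents_product[OF X(1) Y'(1)]])
  have "exponent_product X Y d \<noteq> 0" if "X d \<noteq> 0" for d
  proof -
    have "d dvd N" using that X(1) by (simp add: divisor_exponents_def)
    thus ?thesis using exponent_product_mult[OF pos cop X(1) Y'(1), of d 1] that Y'(2) by simp
  qed
  thus ?thesis
    using prim unfolding primitive_eta_quotient_iff[OF eX X(2)]
      primitive_eta_quotient_iff[OF eXY exponent_product_nonzero[OF pos cop X Y]] by blast
qed

lemma simple_product:
  assumes pos: "N > 0" "M > 0" and cop: "coprime N M" and X: "eta_exponents X" "X \<noteq> (\<lambda>_. 0)"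
    and simple: "simple_eta_quotient N (eta_quotient X)" and Y: "half_weight_shape M Y"
  shows "simple_eta_quotient (M * N) (eta_quotient (exponent_product X Y))"
proof -
  have "Lcm {d. X d \<noteq> 0} = N"
    using simple by (simp add: simple_eta_quotient_def quasi_irreducible_iff[OF pos(1) X])
  hence "divisor_exponents N X" by (auto simp: divisor_exponents_def)
  thus ?thesis
    using simple quasi_irreducible_product[OF pos cop X _ Y] primitive_product[OF pos cop _ X(2) _ Y]
    by (simp add: simple_eta_quotient_def)
qed

lemma irreducible_product:
  assumes pos: "N > 0" "M > 0" and cop: "coprime N M" and X: "eta_exponents X" "X \<noteq> (\<lambda>_. 0)"
    and irr: "irreducible_eta_quotient N (eta_quotient X)" and Y: "half_weight_shape M Y"
  shows "irreducible_eta_quotient (M * N) (eta_quotient (exponent_product X Y))"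
proof -
  have X': "Lcm {d. X d \<noteq> 0} = N" "\<forall>c. cusp_order X c \<ge> 0"
    "\<And>K. K > 0 \<Longrightarrow> N dvd K \<Longrightarrow> irreducible_exponents K X"
    using irr by (auto simp: irreducible_eta_quotient_iff[OF X])
  have dX: "divisor_exponents N X" using X'(1) by (auto simp: divisor_exponents_def)
  have Y': "divisor_exponents M Y" "\<forall>c. cusp_order Y c \<ge> 0"
    using Y by (auto simp: half_weight_shape_def holomorphic_exponents_def)
  have NM: "N * M > 0" using pos by simp
  have eXY: "eta_exponents (exponent_product X Y)"
    by (rule divisor_exponents_imp_eta_exponents[OF NM divisor_exponents_product[OF dX Y'(1)]])
  have "irreducible_exponents K (exponent_product X Y)" if K: "K > 0" "M * N dvd K" for K
  proof -
    obtain N' M' where K': "K = N' * M'" "coprime N' M'" "N dvd N'" "M dvd M'"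
      using coprime_multiple_decomposition[OF K(1) cop] K(2) by (metis mult.commute)
    have pos': "N' > 0" "M' > 0" using K(1) K'(1) by auto
    show ?thesis
      unfolding K'(1)
      by (rule irreducible_exponents_product[OF pos' K'(2) divisor_exponents_dvd[OF dX K'(3)] X'(3)[OF pos'(1) K'(3)]
            divisor_exponents_dvd[OF Y'(1) K'(4)] half_weight_shape_sum[OF Y K'(4) pos'(2)]])
  qed
  thus ?thesis
    using X' Y' Lcm_support_product[OF pos cop X'(1) X(2) Y] exponent_product_nonzero[OF pos cop dX X(2) Y]
    by (simp add: irreducible_eta_quotient_iff[OF eXY] cusp_order_product[OF pos cop dX Y'(1)])
qed

lemma exponent_product_inject:
  assumes pos: "N > 0" "M > 0" and cop: "coprime N M" and X: "divisor_exponents N X" "X \<noteq> (\<lambda>_. 0)"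
    and Y: "divisor_exponents M Y" and Z: "divisor_exponents M Z"
    and eq: "exponent_product X Y = exponent_product X Z"
  shows "Y = Z"
proof
  fix e
  obtain d where d: "X d \<noteq> 0" using X(2) by auto
  hence "d dvd N" using X(1) by (simp add: divisor_exponents_def)
  show "Y e = Z e"
  proof (cases "e dvd M")
    case True
    have "X d * Y e = exponent_product X Y (d * e)"
      by (rule exponent_product_mult[OF pos cop X(1) Y \<open>d dvd N\<close> True, symmetric])
    also have "\<dots> = X d * Z e"
      unfolding eq by (rule exponent_product_mult[OF pos cop X(1) Z \<open>d dvd N\<close> True])
    finally show ?thesis using d by (metis mult_cancel_left)
  next
    case False
    hence "Y e = 0" "Z e = 0" using Y Z by (auto simp: divisor_exponents_def)
    thus ?thesis by simp
  qed
qed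

text \<open>
  Different second factors give different products, since a nonzero exponent of the first factor can
  be cancelled.
\<close>

lemma at_least_products:
  assumes pos: "N > 0" "M > 0" and cop: "coprime N M" and X: "divisor_exponents N X" "X \<noteq> (\<lambda>_. 0)"
    and G: "distinct G" "\<And>Y. Y \<in> set G \<Longrightarrow> half_weight_shape M Y"
    and P: "\<And>Y. half_weight_shape M Y \<Longrightarrow> P (eta_quotient (exponent_product X Y))"
  shows "at_least (length G) P"
proof -
  have NM: "N * M > 0" using pos by simp
  have dY: "divisor_exponents M Y" if "Y \<in> set G" for Y
    using G(2)[OF that] by (simp add: half_weight_shape_def holomorphic_exponents_def)
  have eXY: "eta_exponents (exponent_product X Y)" if "Y \<in> set G" for Y
    by (rule divisor_exponents_imp_eta_exponents[OF NM divisor_exponents_product[OF X(1) dY[OF that]]])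
  have "inj_on (\<lambda>Y. eta_quotient (exponent_product X Y)) (set G)"
    using eXY dY exponent_product_inject[OF pos cop X] by (auto intro!: inj_onI simp: eta_quotient_eq_iff)
  hence "card ((\<lambda>Y. eta_quotient (exponent_product X Y)) ` set G) = length G"
    by (simp add: card_image distinct_card[OF G(1)])
  thus ?thesis
    unfolding at_least_def using G(2) P
    by (intro exI[of _ "(\<lambda>Y. eta_quotient (exponent_product X Y)) ` set G"]) auto
qed

section \<open>The eta quotients of weight one half of level 2, 4, 6 and 12\<close>

definition exponents_of_list :: "(nat \<times> int) list \<Rightarrow> nat \<Rightarrow> int" where
  "exponents_of_list xs d = (case map_of xs d of None \<Rightarrow> 0 | Some x \<Rightarrow> x)"

text \<open>
  Reduces membership to finitely many numerical inequalities, one for each divisor of the level.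
\<close>

lemma half_weight_shape_check:
  assumes M: "M > 0" and D: "{d. d dvd M} = set ds" "distinct ds" and xs: "fst ` set xs \<subseteq> set ds"
    and "sum_list (map (exponents_of_list xs) ds) = 1" "exponents_of_list xs 1 \<noteq> 0" "exponents_of_list xs M \<noteq> 0"
    and pos: "\<forall>c\<in>set ds. (\<Sum>d\<leftarrow>ds. of_nat (gcd c d) ^ 2 / of_nat d * of_int (exponents_of_list xs d)) \<ge> (0::real)"
  shows "half_weight_shape M (exponents_of_list xs)"
proof -
  have dM: "divisor_exponents M (exponents_of_list xs)"
    unfolding divisor_exponents_def
  proof (intro allI impI)
    fix d assume "exponents_of_list xs d \<noteq> 0"
    hence "d \<in> fst ` set xs"
      by (auto simp: exponents_of_list_def split: option.splits dest!: map_of_SomeD intro: rev_image_eqI)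
    with xs D(1) show "d dvd M" by auto
  qed
  have "cusp_order (exponents_of_list xs) c \<ge> 0" for c
  proof -
    have "cusp_order (exponents_of_list xs) c = cusp_order (exponents_of_list xs) (gcd c M)"
      by (rule cusp_order_gcd[OF M dM, symmetric])
    also have "\<dots> = (\<Sum>d\<leftarrow>ds. of_nat (gcd (gcd c M) d) ^ 2 / of_nat d * of_int (exponents_of_list xs d))"
      unfolding cusp_order_divisors[OF M dM] D(1) using D(2) by (simp add: sum_list_distinct_conv_sum_set)
    also have "\<dots> \<ge> 0" using pos D(1) by auto
    finally show ?thesis .
  qed
  moreover have "(\<Sum>e | e dvd M. exponents_of_list xs e) = 1"
    unfolding D(1) using D(2) assms(5) by (simp add: sum_list_distinct_conv_sum_set)
  ultimately show ?thesis
    using dM assms by (simp add: half_weight_shape_def holomorphic_exponents_def)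
qed

lemma divisors_2: "{d. d dvd (2::nat)} = set [1, 2]"
  and divisors_4: "{d. d dvd (4::nat)} = set [1, 2, 4]"
  and divisors_6: "{d. d dvd (6::nat)} = set [1, 2, 3, 6]"
  and divisors_12: "{d. d dvd (12::nat)} = set [1, 2, 3, 4, 6, 12]"
proof -
  have *: "{d. d dvd n} = set ds" if "n > 0" "filter (\<lambda>d. d dvd n) [1..<n + 1] = ds" for n :: nat and ds
    using that by (auto simp: Suc_le_eq less_Suc_eq_le simp del: upt_Suc intro: dvd_pos_nat dest: dvd_imp_le)
  show "{d. d dvd (2::nat)} = set [1, 2]" "{d. d dvd (4::nat)} = set [1, 2, 4]"
    "{d. d dvd (6::nat)} = set [1, 2, 3, 6]" "{d. d dvd (12::nat)} = set [1, 2, 3, 4, 6, 12]"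
    by (rule *, simp, code_simp)+
qed

text \<open>
  Together with \<open>\<eta>\<close> itself, the thirteen exponent vectors below make up Zagier's list of primitive
  holomorphic eta quotients of weight \<open>1/2\<close>.
\<close>

definition shapes2 :: "(nat \<Rightarrow> int) list" where
  "shapes2 = map exponents_of_list [[(1, 2), (2, -1)], [(1, -1), (2, 2)]]"

definition shapes4 :: "(nat \<Rightarrow> int) list" where
  "shapes4 = map exponents_of_list
     [[(1, 1), (2, -1), (4, 1)], [(1, -1), (2, 3), (4, -1)], [(1, -2), (2, 5), (4, -2)]]"

definition shapes6 :: "(nat \<Rightarrow> int) list" where
  "shapes6 = map exponents_of_list
     [[(1, -1), (2, 2), (3, 1), (6, -1)], [(1, 2), (2, -1), (3, -1), (6, 1)],
      [(1, -1), (2, 1), (3, 2), (6, -1)], [(1, 1), (2, -1), (3, -1), (6, 2)]]"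

definition shapes12 :: "(nat \<Rightarrow> int) list" where
  "shapes12 = map exponents_of_list
     [[(1, 1), (2, -1), (3, -1), (4, 1), (6, 2), (12, -1)],
      [(1, -1), (2, 2), (3, 1), (4, -1), (6, -1), (12, 1)],
      [(1, -2), (2, 5), (3, 1), (4, -2), (6, -2), (12, 1)],
      [(1, 1), (2, -2), (3, -2), (4, 1), (6, 5), (12, -2)]]"

lemma distinct_shapes: "distinct shapes2" "distinct shapes4" "distinct shapes6" "distinct shapes12"
proof -
  \<comment> \<open>the exponents at 1 and 2, packed into one integer, already tell the vectors of each level apart\<close>
  have "distinct (map (\<lambda>Y. Y 1 + 10 * Y 2) shapes2)" "distinct (map (\<lambda>Y. Y 1 + 10 * Y 2) shapes4)"
    "distinct (map (\<lambda>Y. Y 1 + 10 * Y 2) shapes6)" "distinct (map (\<lambda>Y. Y 1 + 10 * Y 2) shapes12)"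
    by (simp_all add: shapes2_def shapes4_def shapes6_def shapes12_def exponents_of_list_def)
  thus "distinct shapes2" "distinct shapes4" "distinct shapes6" "distinct shapes12"
    by (simp_all only: distinct_map)
qed

lemma gcd_values:
  "gcd 3 (4::nat) = 1" "gcd 4 (3::nat) = 1" "gcd 4 (6::nat) = 2" "gcd 6 (4::nat) = 2"
  by code_simp+

lemma half_weight_shapes:
  "Y \<in> set shapes2 \<Longrightarrow> half_weight_shape 2 Y"
  "Y \<in> set shapes4 \<Longrightarrow> half_weight_shape 4 Y"
  "Y \<in> set shapes6 \<Longrightarrow> half_weight_shape 6 Y"
  "Y \<in> set shapes12 \<Longrightarrow> half_weight_shape 12 Y"
proof -
  show "half_weight_shape 2 Y" if "Y \<in> set shapes2"
    using that unfolding shapes2_def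
    by (auto intro!: half_weight_shape_check[OF _ divisors_2] simp: exponents_of_list_def)
  show "half_weight_shape 4 Y" if "Y \<in> set shapes4"
    using that unfolding shapes4_def
    by (auto intro!: half_weight_shape_check[OF _ divisors_4] simp: exponents_of_list_def)
  show "half_weight_shape 6 Y" if "Y \<in> set shapes6"
    using that unfolding shapes6_def
    by (auto intro!: half_weight_shape_check[OF _ divisors_6] simp: exponents_of_list_def)
  show "half_weight_shape 12 Y" if "Y \<in> set shapes12"
    using that unfolding shapes12_def
    by (auto intro!: half_weight_shape_check[OF _ divisors_12] simp: exponents_of_list_def gcd_values)
qed

section \<open>Counting simple and irreducible eta quotients\<close>

lemma irreducible_eta:
  "irreducible_eta_quotient 1 (eta_quotient ((\<lambda>_. 0)(1 := 1)))"
proof -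
  let ?E = "(\<lambda>_. 0)(1 := 1) :: nat \<Rightarrow> int"
  have E: "eta_exponents ?E" "?E \<noteq> (\<lambda>_. 0)" "Lcm {d. ?E d \<noteq> 0} = 1"
    by (auto simp: eta_exponents_def fun_eq_iff)
  have "\<forall>c. cusp_order ?E c \<ge> 0"
    using holomorphic_exponents_eta by (simp add: holomorphic_exponents_def)
  thus ?thesis
    unfolding irreducible_eta_quotient_iff[OF E(1,2)] using E(3) irreducible_exponents_eta by blast
qed

lemma simple_eta:
  "simple_eta_quotient 1 (eta_quotient ((\<lambda>_. 0)(1 := 1)))"
proof -
  let ?E = "(\<lambda>_. 0)(1 := 1) :: nat \<Rightarrow> int"
  have E: "eta_exponents ?E" "?E \<noteq> (\<lambda>_. 0)"
    by (auto simp: eta_exponents_def fun_eq_iff)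
  have "primitive_eta_quotient (eta_quotient ?E)"
    unfolding primitive_eta_quotient_iff[OF E] by auto
  moreover have "quasi_irreducible 1 (eta_quotient ?E)"
    using irreducible_eta unfolding irreducible_eta_quotient_def quasi_irreducible_def by auto
  ultimately show ?thesis
    by (simp add: simple_eta_quotient_def)
qed

text \<open>
  At level 1 the given quotient may be the constant 1, whose products are again constant. In that
  case \<open>\<eta>\<close> takes its place.
\<close>

lemma nonzero_exponents_of_level:
  assumes lev: "has_level f N" and eta: "N = 1 \<Longrightarrow> P (eta_quotient ((\<lambda>_. 0)(1 := 1)))" and f: "P f"
  shows "\<exists>X. N > 0 \<and> eta_exponents X \<and> X \<noteq> (\<lambda>_. 0) \<and> divisor_exponents N X \<and> P (eta_quotient X)"
proof -
  obtain X where X: "eta_exponents X" "f = eta_quotient X" "N = Lcm {d. X d \<noteq> 0}"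
    using lev by (auto simp: has_level_def)
  show ?thesis
  proof (cases "X = (\<lambda>_. 0)")
    case True
    hence "N = 1" using X(3) by simp
    thus ?thesis
      using eta by (intro exI[of _ "(\<lambda>_. 0)(1 := 1)"])
        (auto simp: eta_exponents_def divisor_exponents_def fun_eq_iff)
  next
    case False
    have "divisor_exponents N X" using X(3) by (auto simp: divisor_exponents_def)
    thus ?thesis using False X f level_pos[OF lev] by blast
  qed
qed

text \<open>
  Both versions of the theorem are instances of this with \<open>P\<close> the property that is preserved by
  products with second factors of weight \<open>1/2\<close>.
\<close>

lemma at_least_of_shapes:
  assumes N: "odd N" "N > 0" and X: "divisor_exponents N X" "X \<noteq> (\<lambda>_. 0)"
    and P: "\<And>M Y. M > 0 \<Longrightarrow> coprime N M \<Longrightarrow> half_weight_shape M Y \<Longrightarrow> P (M * N) (eta_quotient (exponent_product X Y))"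
  shows "at_least 2 (P (2 * N)) \<and> at_least 3 (P (4 * N)) \<and>
           (\<not> 3 dvd N \<longrightarrow> at_least 4 (P (6 * N)) \<and> at_least 4 (P (12 * N)))"
proof -
  have *: "at_least (length G) (P (M * N))"
    if "M > 0" "coprime N M" "distinct G" "\<And>Y. Y \<in> set G \<Longrightarrow> half_weight_shape M Y" for M G
  proof (rule at_least_products[OF N(2) that(1,2) X that(3)])
    show "half_weight_shape M Y" if "Y \<in> set G" for Y
      using that \<open>\<And>Y. Y \<in> set G \<Longrightarrow> half_weight_shape M Y\<close> by blast
    show "P (M * N) (eta_quotient (exponent_product X Y))" if "half_weight_shape M Y" for Y
      by (rule P[OF \<open>M > 0\<close> \<open>coprime N M\<close> that])
  qed
  have c2: "coprime N 2" using N(1) by (simp add: coprime_right_2_iff_odd)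
  have c4: "coprime N 4" using coprime_power_right_iff[of N 2 2] c2 by simp
  have c3: "coprime N 3" if "\<not> 3 dvd N"
    using that prime_imp_coprime[of 3 N] by (simp add: coprime_commute)
  have c6: "coprime N 6" if "\<not> 3 dvd N"
    using coprime_mult_right_iff[of N 2 3] c2 c3[OF that] by simp
  have c12: "coprime N 12" if "\<not> 3 dvd N"
    using coprime_mult_right_iff[of N 4 3] c4 c3[OF that] by simp
  have len: "length shapes2 = 2" "length shapes4 = 3" "length shapes6 = 4" "length shapes12 = 4"
    by (simp_all add: shapes2_def shapes4_def shapes6_def shapes12_def)
  show ?thesis
    using *[OF _ c2 distinct_shapes(1) half_weight_shapes(1)] *[OF _ c4 distinct_shapes(2) half_weight_shapes(2)]
      *[OF _ c6 distinct_shapes(3) half_weight_shapes(3)] *[OF _ c12 distinct_shapes(4) half_weight_shapes(4)]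
    by (simp add: len)
qed

theorem corollary1:
  fixes N :: nat
  assumes "odd N"
  shows
    "((\<exists>f. simple_eta_quotient N f) \<longrightarrow>
        at_least 2 (simple_eta_quotient (2 * N)) \<and>
        at_least 3 (simple_eta_quotient (4 * N)) \<and>
        (\<not> 3 dvd N \<longrightarrow>
          at_least 4 (simple_eta_quotient (6 * N)) \<and>
          at_least 4 (simple_eta_quotient (12 * N)))) \<and>
     ((\<exists>f. irreducible_eta_quotient N f) \<longrightarrow>
        at_least 2 (irreducible_eta_quotient (2 * N)) \<and>
        at_least 3 (irreducible_eta_quotient (4 * N)) \<and>
        (\<not> 3 dvd N \<longrightarrow>
          at_least 4 (irreducible_eta_quotient (6 * N)) \<and>
          at_least 4 (irreducible_eta_quotient (12 * N))))"
proof (intro conjI[of "_ \<longrightarrow> _"] impI)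
  assume "\<exists>f. simple_eta_quotient N f"
  then obtain f where f: "simple_eta_quotient N f" ..
  hence "has_level f N" by (simp add: simple_eta_quotient_def quasi_irreducible_def)
  then obtain X where X: "N > 0" "eta_exponents X" "X \<noteq> (\<lambda>_. 0)" "divisor_exponents N X"
    "simple_eta_quotient N (eta_quotient X)"
    using nonzero_exponents_of_level[of f N "simple_eta_quotient N"] simple_eta f by auto
  show "at_least 2 (simple_eta_quotient (2 * N)) \<and> at_least 3 (simple_eta_quotient (4 * N)) \<and>
        (\<not> 3 dvd N \<longrightarrow> at_least 4 (simple_eta_quotient (6 * N)) \<and> at_least 4 (simple_eta_quotient (12 * N)))"
    by (rule at_least_of_shapes[where P = simple_eta_quotient, OF assms X(1,4,3)])
       (rule simple_product[OF X(1) _ _ X(2,3,5)])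
next
  assume "\<exists>f. irreducible_eta_quotient N f"
  then obtain f where f: "irreducible_eta_quotient N f" ..
  hence "has_level f N" by (simp add: irreducible_eta_quotient_def)
  then obtain X where X: "N > 0" "eta_exponents X" "X \<noteq> (\<lambda>_. 0)" "divisor_exponents N X"
    "irreducible_eta_quotient N (eta_quotient X)"
    using nonzero_exponents_of_level[of f N "irreducible_eta_quotient N"] irreducible_eta f by auto
  show "at_least 2 (irreducible_eta_quotient (2 * N)) \<and> at_least 3 (irreducible_eta_quotient (4 * N)) \<and>
        (\<not> 3 dvd N \<longrightarrow> at_least 4 (irreducible_eta_quotient (6 * N)) \<and> at_least 4 (irreducible_eta_quotient (12 * N)))"
    by (rule at_least_of_shapes[where P = irreducible_eta_quotient, OF assms X(1,4,3)])
       (rule irreducible_product[OF X(1) _ _ X(2,3,5)])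
qed

end
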